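(* Let $\mathbb D$ be the projective Fraïssé limit of the family $\mathcal{T}_{\mathcal{M}3}$. Then $E(\mathbb D)$ is transitive, and the topological realization $|\mathbb D|$ is a dendrite whose set of ramification points is dense.
   Context: A graph is a pair $A=(V(A),E(A))$ with $E(A)\subseteq V(A)^2$ reflexive and symmetric. An epimorphism is a map on vertices sending edges to edges that is surjective on vertices and on edges. A topological graph is a graph whose vertex set is a compact, zero-dimensional, second-countable space and whose edge set is closed; epimorphisms between topological graphs are continuous. A subset $S\subseteq V(G)$ is disconnected if $S=P\cup Q$ with $P,Q$ nonempty disjoint closed and no edge between $P$ and $Q$; otherwise connected. An epimorphism is monotone if preimages of closed connected sets are connected. A tree is a finite graph in which any two distinct vertices are joined by a unique path of pairwise distinct vertices; the order of a vertex is the number of non-degenerate edges containing it. $\mathcal{T}_{\mathcal{M}3}$ is the class of trees with at least two vertices, all of order $\le 3$, with all monotone epimorphisms between them; it is a projective Fraïssé family, i.e. countably many isomorphism types, the epimorphisms are closed under composition and contain identities, and it has the joint projection and amalgamation properties. For such a family $\mathcal F$, $\mathcal F^\omega$ consists of inverse limits $\varprojlim\{F_n,\alpha_n\}$ with $F_n\in\mathcal F$ and bonding maps $\alpha_n$ in the family, with $\langle(a_n),(b_n)\rangle$ an edge iff $\langle a_n,b_n\rangle\in E(F_n)$ for all $n$; an epimorphism $h$ from such a limit to $A\in\mathcal F$ is in $\mathcal F^\omega$ iff $h=h'\circ\alpha^\infty_m$ for some $m$ and some $h'\colon F_m\to A$ in the family ($\alpha^\infty_m$ the projection). The projective Fraïssé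 limit is the unique $\mathbb F\in\mathcal F^\omega$ such that (i) for each $A\in\mathcal F$ there is an epimorphism $\mathbb F\to A$ in $\mathcal F^\omega$, and (ii) for $A,B\in\mathcal F$, $f\colon\mathbb F\to A$ in $\mathcal F^\omega$ and $g\colon B\to A$ in the family there is $h\colon \mathbb F\to B$ in $\mathcal F^\omega$ with $f=g\circ h$. When $E(\mathbb F)$ is transitive (hence an equivalence relation), the topological realization $|\mathbb F|$ is the quotient space $V(\mathbb F)/E(\mathbb F)$. A dendrite is a locally connected continuum that is hereditarily unicoherent and arcwise connected; a point $p$ of a continuum is a ramification point if it is the common endpoint of three arcs pairwise meeting only in $p$. *)

theory Defs
  imports "HOL-Analysis.Analysis"
begin

record fgraph =
  gV :: "nat set"
  gE :: "(nat \<times> nat) set"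

definition is_graph :: "fgraph \<Rightarrow> bool" where
  "is_graph G \<longleftrightarrow> gE G \<subseteq> gV G \<times> gV G
     \<and> (\<forall>x\<in>gV G. (x, x) \<in> gE G)
     \<and> (\<forall>x y. (x, y) \<in> gE G \<longrightarrow> (y, x) \<in> gE G)"

definition gpath :: "fgraph \<Rightarrow> nat list \<Rightarrow> nat \<Rightarrow> nat \<Rightarrow> bool" where
  "gpath G p a b \<longleftrightarrow> p \<noteq> [] \<and> hd p = a \<and> last p = b \<and> distinct p
     \<and> set p \<subseteq> gV G \<and> (\<forall>i. Suc i < length p \<longrightarrow> (p ! i, p ! Suc i) \<in> gE G)"

definition is_tree :: "fgraph \<Rightarrow> bool" where
  "is_tree G \<longleftrightarrow> is_graph G \<and> finite (gV G)
     \<and> (\<forall>a\<in>gV G. \<forall>b\<in>gV G. a \<noteq> b \<longrightarrow> (\<exists>!p. gpath G p a b))"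

definition vorder :: "fgraph \<Rightarrow> nat \<Rightarrow> nat" where
  "vorder G v = card {w. w \<noteq> v \<and> (v, w) \<in> gE G}"

definition tm3_obj :: "fgraph \<Rightarrow> bool" where
  "tm3_obj G \<longleftrightarrow> is_tree G \<and> 2 \<le> card (gV G) \<and> (\<forall>v\<in>gV G. vorder G v \<le> 3)"

text \<open>Connectedness of a subset of a finite graph (finite graphs carry the
  discrete topology, so every subset is closed).\<close>
definition gconnected :: "fgraph \<Rightarrow> nat set \<Rightarrow> bool" where
  "gconnected G S \<longleftrightarrow> \<not> (\<exists>P Q. P \<noteq> {} \<and> Q \<noteq> {} \<and> P \<inter> Q = {} \<and> S = P \<union> Q
       \<and> (\<forall>x\<in>P. \<forall>y\<in>Q. (x, y) \<notin> gE G))"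

definition gepi :: "fgraph \<Rightarrow> fgraph \<Rightarrow> (nat \<Rightarrow> nat) \<Rightarrow> bool" where
  "gepi A B f \<longleftrightarrow> (\<forall>x\<in>gV A. f x \<in> gV B)
     \<and> (\<forall>x y. (x, y) \<in> gE A \<longrightarrow> (f x, f y) \<in> gE B)
     \<and> f ` gV A = gV B
     \<and> (\<lambda>(x, y). (f x, f y)) ` gE A = gE B"

definition gmonotone :: "fgraph \<Rightarrow> fgraph \<Rightarrow> (nat \<Rightarrow> nat) \<Rightarrow> bool" where
  "gmonotone A B f \<longleftrightarrow> (\<forall>S\<subseteq>gV B. gconnected B S \<longrightarrow> gconnected A {x\<in>gV A. f x \<in> S})"

definition tm3_mor :: "fgraph \<Rightarrow> fgraph \<Rightarrow> (nat \<Rightarrow> nat) \<Rightarrow> bool" where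
  "tm3_mor A B f \<longleftrightarrow> tm3_obj A \<and> tm3_obj B \<and> gepi A B f \<and> gmonotone A B f"

definition tm3_invseq :: "(nat \<Rightarrow> fgraph) \<Rightarrow> (nat \<Rightarrow> nat \<Rightarrow> nat) \<Rightarrow> bool" where
  "tm3_invseq F \<alpha> \<longleftrightarrow> (\<forall>n. tm3_mor (F (Suc n)) (F n) (\<alpha> n))"

definition limV :: "(nat \<Rightarrow> fgraph) \<Rightarrow> (nat \<Rightarrow> nat \<Rightarrow> nat) \<Rightarrow> (nat \<Rightarrow> nat) set" where
  "limV F \<alpha> = {x. \<forall>n. x n \<in> gV (F n) \<and> \<alpha> n (x (Suc n)) = x n}"

definition limE :: "(nat \<Rightarrow> fgraph) \<Rightarrow> (nat \<Rightarrow> nat \<Rightarrow> nat) \<Rightarrow> ((nat \<Rightarrow> nat) \<times> (nat \<Rightarrow> nat)) set" where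
  "limE F \<alpha> = {(x, y). x \<in> limV F \<alpha> \<and> y \<in> limV F \<alpha> \<and> (\<forall>n. (x n, y n) \<in> gE (F n))}"

definition limtop :: "(nat \<Rightarrow> fgraph) \<Rightarrow> (nat \<Rightarrow> nat \<Rightarrow> nat) \<Rightarrow> (nat \<Rightarrow> nat) topology" where
  "limtop F \<alpha> = subtopology (product_topology (\<lambda>_. discrete_topology (UNIV :: nat set)) UNIV) (limV F \<alpha>)"

definition fomega_epi :: "(nat \<Rightarrow> fgraph) \<Rightarrow> (nat \<Rightarrow> nat \<Rightarrow> nat) \<Rightarrow> fgraph \<Rightarrow> ((nat \<Rightarrow> nat) \<Rightarrow> nat) \<Rightarrow> bool" where
  "fomega_epi F \<alpha> A h \<longleftrightarrow>
     (\<forall>x\<in>limV F \<alpha>. h x \<in> gV A)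
     \<and> (\<forall>x y. (x, y) \<in> limE F \<alpha> \<longrightarrow> (h x, h y) \<in> gE A)
     \<and> h ` limV F \<alpha> = gV A
     \<and> (\<lambda>(x, y). (h x, h y)) ` limE F \<alpha> = gE A
     \<and> (\<exists>m h'. tm3_mor (F m) A h' \<and> (\<forall>x\<in>limV F \<alpha>. h x = h' (x m)))"

definition tm3_fraisse_limit :: "(nat \<Rightarrow> fgraph) \<Rightarrow> (nat \<Rightarrow> nat \<Rightarrow> nat) \<Rightarrow> bool" where
  "tm3_fraisse_limit F \<alpha> \<longleftrightarrow> tm3_invseq F \<alpha>
     \<and> (\<forall>A. tm3_obj A \<longrightarrow> (\<exists>h. fomega_epi F \<alpha> A h))
     \<and> (\<forall>A B f g. tm3_obj A \<and> tm3_obj B \<and> fomega_epi F \<alpha> A f \<and> tm3_mor B A g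
          \<longrightarrow> (\<exists>h. fomega_epi F \<alpha> B h \<and> (\<forall>x\<in>limV F \<alpha>. f x = g (h x))))"

text \<open>Quotient topology of X by a relation R (meant to be an equivalence on topspace X):
  points are the classes; a set of classes is open iff its union is open in X.\<close>
definition quotient_top :: "'a topology \<Rightarrow> ('a \<times> 'a) set \<Rightarrow> 'a set topology" where
  "quotient_top X R = topology (\<lambda>U. U \<subseteq> topspace X // R \<and> openin X (\<Union>U))"

definition realization :: "(nat \<Rightarrow> fgraph) \<Rightarrow> (nat \<Rightarrow> nat \<Rightarrow> nat) \<Rightarrow> (nat \<Rightarrow> nat) set topology" where
  "realization F \<alpha> = quotient_top (limtop F \<alpha>) (limE F \<alpha>)"

definition arc_in :: "'a topology \<Rightarrow> (real \<Rightarrow> 'a) \<Rightarrow> bool" where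
  "arc_in X g \<longleftrightarrow> embedding_map (top_of_set {0..1::real}) X g"

definition continuum :: "'a topology \<Rightarrow> bool" where
  "continuum X \<longleftrightarrow> topspace X \<noteq> {} \<and> compact_space X \<and> connected_space X \<and> metrizable_space X"

definition hereditarily_unicoherent :: "'a topology \<Rightarrow> bool" where
  "hereditarily_unicoherent X \<longleftrightarrow>
     (\<forall>A B. closedin X A \<and> connectedin X A \<and> A \<noteq> {} \<and> closedin X B \<and> connectedin X B \<and> B \<noteq> {}
        \<longrightarrow> connectedin X (A \<inter> B))"

definition arcwise_connected :: "'a topology \<Rightarrow> bool" where
  "arcwise_connected X \<longleftrightarrow>
     (\<forall>x\<in>topspace X. \<forall>y\<in>topspace X. x \<noteq> y \<longrightarrow> (\<exists>g. arc_in X g \<and> g 0 = x \<and> g 1 = y))"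

definition dendrite :: "'a topology \<Rightarrow> bool" where
  "dendrite X \<longleftrightarrow> continuum X \<and> locally_connected_space X \<and> hereditarily_unicoherent X
     \<and> arcwise_connected X"

definition ramification_point :: "'a topology \<Rightarrow> 'a \<Rightarrow> bool" where
  "ramification_point X p \<longleftrightarrow> (\<exists>g1 g2 g3. arc_in X g1 \<and> arc_in X g2 \<and> arc_in X g3
     \<and> g1 0 = p \<and> g2 0 = p \<and> g3 0 = p
     \<and> g1 ` {0..1} \<inter> g2 ` {0..1} = {p}
     \<and> g1 ` {0..1} \<inter> g3 ` {0..1} = {p}
     \<and> g2 ` {0..1} \<inter> g3 ` {0..1} = {p})"

end

(*
  A monotone map between trees sends the path joining two vertices onto the path joining their
  images. Hence in the limit D any two points x, y span a segment, the inverse limit of the paths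
  joining x n and y n. Distributing a unit mass over these paths, compatibly with the bonding maps,
  gives a continuous monotone map of the segment onto [0,1] that identifies exactly the adjacent
  points, so the segment becomes an arc in the realization. Connectedness in the realization is read
  off from the finite levels: the image of a closed subset of D is connected iff all its projections
  are, which reduces local connectedness to stars of vertices and hereditary unicoherence to the fact
  that connected subsets of a tree have connected intersection.
  The extension property of the limit enters twice. Subdividing an edge shows that adjacency is
  transitive. Refining a vertex into a tripod produces three points whose median lies over that vertex
  and is not adjacent to any of them, so the arcs from the median to the three points meet only there.
*)

theory Submission
  imports Defs
begin

section \<open>Paths, intervals and medians in trees\<close>

text \<open>The delicate point is that the masses vanish along every thread of a segment. A point
  keeps its mass bounded away from 0 exactly when from some level on no other vertex of the path
  lies above its projection. Inside the segment such a point would have an adjacent point on either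
  side; transitivity makes these two adjacent to each other, which leaves no room for a third point
  between them. So transitivity serves the arcs as well as the quotient. At an end of the segment
  only one side exists and the argument breaks down: an end may have a neighbour in the segment and
  keep its mass. The ends are therefore first moved within their classes, which changes nothing in
  the realization. The bound 3 on the orders shapes the tripod: a vertex of order 3 admits no
  further leg, so the centre of the tripod is a new vertex put on one of its edges.\<close>

lemma gpath_iff:
  "gpath G p a b \<longleftrightarrow> p \<noteq> [] \<and> hd p = a \<and> last p = b \<and> distinct p \<and> set p \<subseteq> gV G
     \<and> successively (\<lambda>x y. (x, y) \<in> gE G) p"
  by (auto simp: gpath_def successively_conv_nth)

lemma gpath_single: "a \<in> gV G \<Longrightarrow> gpath G [a] a a"
  by (simp add: gpath_iff)

lemma gpath_snoc:
  "gpath G p a x \<Longrightarrow> (x, y) \<in> gE G \<Longrightarrow> y \<in> gV G \<Longrightarrow> y \<notin> set p \<Longrightarrow> gpath G (p @ [y]) a y"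
  by (auto simp: gpath_iff successively_append_iff)

lemma gpath_prefix: "gpath G (p @ y # q) a b \<Longrightarrow> gpath G (p @ [y]) a y"
  by (auto simp: gpath_iff successively_append_iff hd_append split: if_splits)

lemma gpath_suffix: "gpath G (p @ y # q) a b \<Longrightarrow> gpath G (y # q) y b"
  by (auto simp: gpath_iff successively_append_iff)

text \<open>A vertex that the path has already met is not appended; the path is cut there instead,
  which keeps it free of repetitions.\<close>

lemma gpath_step:
  assumes "gpath G p a x" "(x, y) \<in> gE G" "y \<in> gV G"
  shows "\<exists>q. gpath G q a y \<and> set q \<subseteq> insert y (set p)"
proof (cases "y \<in> set p")
  case True
  then obtain q r where p: "p = q @ y # r" by (meson split_list)
  then have "gpath G (q @ [y]) a y" using assms gpath_prefix by blast
  then show ?thesis using p by (intro exI[of _ "q @ [y]"]) auto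
next
  case False
  then show ?thesis using gpath_snoc[OF assms] by (intro exI[of _ "p @ [y]"]) auto
qed

lemma gpath_concat:
  assumes "gpath G p a c" "gpath G q c b" "set p \<inter> set q \<subseteq> {c}"
  shows "gpath G (p @ tl q) a b"
proof -
  obtain q' where q: "q = c # q'" using assms(2) by (cases q) (auto simp: gpath_iff)
  have p: "p \<noteq> []" "last p = c" "hd p = a" "distinct p" "set p \<subseteq> gV G"
    "successively (\<lambda>x y. (x, y) \<in> gE G) p" using assms(1) by (simp_all add: gpath_iff)
  have q': "c \<notin> set q'" "distinct q'" "set q' \<subseteq> gV G" "last (c # q') = b"
    "successively (\<lambda>x y. (x, y) \<in> gE G) (c # q')"
    using assms(2) by (simp_all add: gpath_iff q)
  have "set p \<inter> set q' = {}" using assms(3) q'(1) by (auto simp: q)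
  then show ?thesis
    using p q' by (cases q') (simp_all add: gpath_iff successively_append_iff q)
qed

section \<open>Connected vertex sets of a finite graph\<close>

lemma gconnectedI:
  assumes "\<And>P. P \<subseteq> S \<Longrightarrow> P \<noteq> {} \<Longrightarrow> (\<And>x y. x \<in> P \<Longrightarrow> y \<in> S - P \<Longrightarrow> (x, y) \<notin> gE G) \<Longrightarrow> P = S"
  shows "gconnected G S"
  unfolding gconnected_def
proof
  assume "\<exists>P Q. P \<noteq> {} \<and> Q \<noteq> {} \<and> P \<inter> Q = {} \<and> S = P \<union> Q \<and> (\<forall>x\<in>P. \<forall>y\<in>Q. (x, y) \<notin> gE G)"
  then obtain P Q where *: "P \<noteq> {}" "Q \<noteq> {}" "P \<inter> Q = {}" "S = P \<union> Q" "\<forall>x\<in>P. \<forall>y\<in>Q. (x, y) \<notin> gE G"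
    by (elim exE conjE)
  then have "P = S" using assms[of P] by auto
  with * show False by (metis Un_upper2 inf.absorb_iff2)
qed

lemma gconnectedD:
  assumes "gconnected G S" "P \<subseteq> S" "P \<noteq> {}" "\<And>x y. x \<in> P \<Longrightarrow> y \<in> S - P \<Longrightarrow> (x, y) \<notin> gE G"
  shows "P = S"
proof (rule ccontr)
  assume "P \<noteq> S"
  with assms(2) have "S - P \<noteq> {}" "S = P \<union> (S - P)" "P \<inter> (S - P) = {}" by auto
  moreover have "\<forall>x\<in>P. \<forall>y\<in>S - P. (x, y) \<notin> gE G" using assms(4) by simp
  ultimately have "\<exists>P Q. P \<noteq> {} \<and> Q \<noteq> {} \<and> P \<inter> Q = {} \<and> S = P \<union> Q \<and> (\<forall>x\<in>P. \<forall>y\<in>Q. (x, y) \<notin> gE G)"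
    using assms(3) by (intro exI[of _ P] exI[of _ "S - P"] conjI)
  then show False using assms(1) unfolding gconnected_def by (rule notE[rotated])
qed

lemma gconnected_cross:
  assumes "gconnected G T" "a \<in> T" "a \<in> S" "c \<in> T" "c \<notin> S"
  obtains x y where "x \<in> T" "x \<in> S" "y \<in> T" "y \<notin> S" "(x, y) \<in> gE G"
proof -
  have "\<exists>x y. x \<in> T \<and> x \<in> S \<and> y \<in> T \<and> y \<notin> S \<and> (x, y) \<in> gE G"
  proof (rule ccontr)
    assume *: "\<not> ?thesis"
    have "T \<inter> S = T" by (rule gconnectedD[OF assms(1)]) (use assms * in auto)
    then show False using assms by blast
  qed
  then show thesis using that by blast
qed

lemma gconnected_empty [simp]: "gconnected G {}"
  by (rule gconnectedI) auto

lemma gconnected_single [simp]: "gconnected G {a}"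
  by (rule gconnectedI) auto

lemma gconnected_edge:
  assumes "is_graph G" "(a, b) \<in> gE G"
  shows "gconnected G {a, b}"
proof (rule gconnectedI)
  fix P assume P: "P \<subseteq> {a, b}" "P \<noteq> {}" "\<And>x y. x \<in> P \<Longrightarrow> y \<in> {a, b} - P \<Longrightarrow> (x, y) \<notin> gE G"
  have "(b, a) \<in> gE G" using assms by (auto simp: is_graph_def)
  with P assms show "P = {a, b}" by blast
qed

lemma gconnected_star:
  assumes "a \<in> S" "\<And>b. b \<in> S \<Longrightarrow> \<exists>T\<subseteq>S. a \<in> T \<and> b \<in> T \<and> gconnected G T"
  shows "gconnected G S"
proof (rule gconnectedI)
  fix P assume P: "P \<subseteq> S" "P \<noteq> {}" "\<And>x y. x \<in> P \<Longrightarrow> y \<in> S - P \<Longrightarrow> (x, y) \<notin> gE G"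
  have tr: "T \<subseteq> P" if "T \<subseteq> S" "gconnected G T" "P \<inter> T \<noteq> {}" for T
  proof -
    have "P \<inter> T = T" by (rule gconnectedD[OF that(2)]) (use that P(3) in auto)
    then show ?thesis by blast
  qed
  obtain x where "x \<in> P" using P by auto
  then have "x \<in> S" using P(1) by blast
  from assms(2)[OF this] obtain T where "T \<subseteq> S" "a \<in> T" "x \<in> T" "gconnected G T" by blast
  then have "a \<in> P" using tr[of T] \<open>x \<in> P\<close> by blast
  show "P = S"
  proof
    show "S \<subseteq> P"
    proof
      fix b assume "b \<in> S"
      from assms(2)[OF this] obtain T where "T \<subseteq> S" "a \<in> T" "b \<in> T" "gconnected G T" by blast
      then show "b \<in> P" using tr[of T] \<open>a \<in> P\<close> by blast
    qed
  qed (rule P)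
qed

lemma gconnected_Un:
  assumes "gconnected G S" "gconnected G T" "S \<inter> T \<noteq> {}"
  shows "gconnected G (S \<union> T)"
proof -
  obtain a where a: "a \<in> S" "a \<in> T" using assms by auto
  show ?thesis
  proof (rule gconnected_star[of a])
    fix b assume "b \<in> S \<union> T"
    then show "\<exists>U\<subseteq>S \<union> T. a \<in> U \<and> b \<in> U \<and> gconnected G U"
      using assms a by (metis Un_iff Un_upper1 Un_upper2)
  qed (use a in blast)
qed

lemma gconnected_image:
  assumes "gconnected A S" "\<And>x y. x \<in> S \<Longrightarrow> y \<in> S \<Longrightarrow> (x, y) \<in> gE A \<Longrightarrow> (f x, f y) \<in> gE B"
  shows "gconnected B (f ` S)"
proof (rule gconnectedI)
  fix P assume P: "P \<subseteq> f ` S" "P \<noteq> {}" "\<And>x y. x \<in> P \<Longrightarrow> y \<in> f ` S - P \<Longrightarrow> (x, y) \<notin> gE B"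
  have "{x\<in>S. f x \<in> P} = S"
  proof (rule gconnectedD[OF assms(1)])
    fix x y assume "x \<in> {x\<in>S. f x \<in> P}" "y \<in> S - {x\<in>S. f x \<in> P}"
    then show "(x, y) \<notin> gE A" using assms(2)[of x y] P(3)[of "f x" "f y"] by blast
  qed (use P in auto)
  with P show "P = f ` S" by auto
qed

lemma gpath_connected:
  assumes "is_graph G" "gpath G p a b"
  shows "gconnected G (set p)"
proof -
  have "gconnected G (set p)" if "p \<noteq> []" "successively (\<lambda>x y. (x, y) \<in> gE G) p" for p
    using that
  proof (induction p rule: rev_induct)
    case (snoc y p)
    show ?case
    proof (cases "p = []")
      case False
      then have "gconnected G (set p)" "(last p, y) \<in> gE G"
        using snoc by (auto simp: successively_append_iff)
      then have "gconnected G (set p \<union> {last p, y})"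
        using False gconnected_edge[OF assms(1)] by (intro gconnected_Un) auto
      moreover have "set p \<union> {last p, y} = set (p @ [y])" using False by auto
      ultimately show ?thesis by metis
    qed simp
  qed simp
  then show ?thesis using assms by (auto simp: gpath_iff)
qed

text \<open>The vertices reachable from \<open>a\<close> inside \<open>S\<close> form a part that no
  edge of \<open>S\<close> leaves, by \<open>gpath_step\<close>.\<close>

lemma gconnected_imp_gpath:
  assumes "gconnected G S" "S \<subseteq> gV G" "a \<in> S" "b \<in> S"
  shows "\<exists>p. gpath G p a b \<and> set p \<subseteq> S"
proof -
  let ?P = "{w\<in>S. \<exists>p. gpath G p a w \<and> set p \<subseteq> S}"
  have "?P = S"
  proof (rule gconnectedD[OF assms(1)])
    have "gpath G [a] a a" using assms by (auto intro: gpath_single)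
    then have "a \<in> ?P" using assms by (auto intro!: exI[of _ "[a]"])
    then show "?P \<noteq> {}" by blast
    fix x y assume x: "x \<in> ?P" and y: "y \<in> S - ?P"
    show "(x, y) \<notin> gE G"
    proof
      assume "(x, y) \<in> gE G"
      moreover obtain p where "gpath G p a x" "set p \<subseteq> S" using x by blast
      ultimately obtain q where "gpath G q a y" "set q \<subseteq> insert y (set p)"
        using gpath_step[of G p a x y] y assms(2) by blast
      then have "y \<in> ?P" using y \<open>set p \<subseteq> S\<close> by auto
      then show False using y by blast
    qed
  qed auto
  then show ?thesis using assms(4) by blast
qed

text \<open>Trees are the connected graphs in which every edge is a bridge; this form is the one that
  is stable under elementary modifications of the graph.\<close>

lemma tree_if_cuts:
  assumes G: "is_graph G" "finite (gV G)" "gconnected G (gV G)"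
    and cut: "\<And>a b. (a, b) \<in> gE G \<Longrightarrow> a \<noteq> b \<Longrightarrow>
      \<exists>S\<subseteq>gV G. a \<in> S \<and> b \<notin> S \<and> (\<forall>u\<in>S. \<forall>w\<in>gV G - S. (u, w) \<in> gE G \<longrightarrow> u = a \<and> w = b)"
  shows "is_tree G"
proof -
  \<comment> \<open>The second vertex of a path is forced: by the cut of the edge from
    \<open>a\<close> to \<open>b\<close>, only \<open>a\<close> has an edge leaving the side
    \<open>S\<close> of \<open>a\<close>. The rest of the given path avoids \<open>a\<close>, so its
    end \<open>c\<close> lies outside \<open>S\<close>; another second vertex would lie in
    \<open>S\<close>, and the path could not leave \<open>S\<close> any more.\<close>
  have start: "p' = a # b # r" if p: "gpath G (a # b # q) a c" and p': "gpath G p' a c"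
    and p'e: "p' = a # b' # r" for a b c q p' b' r
  proof -
    have ab: "(a, b) \<in> gE G" "a \<noteq> b" using p by (auto simp: gpath_iff)
    then obtain S where S: "S \<subseteq> gV G" "a \<in> S" "b \<notin> S"
      "\<And>u w. u \<in> S \<Longrightarrow> w \<in> gV G - S \<Longrightarrow> (u, w) \<in> gE G \<Longrightarrow> u = a \<and> w = b"
      using cut by meson
    have "c \<notin> S"
    proof
      assume "c \<in> S"
      have "gconnected G (set (b # q))"
        using gpath_connected[OF G(1), of "b # q" b c] gpath_suffix[of G "[a]" b q a c] p by auto
      moreover have "c \<in> set (b # q)"
        using p last_in_set[of "b # q"] by (auto simp: gpath_iff)
      ultimately obtain x y where "x \<in> set (b # q)" "x \<in> S" "y \<in> set (b # q)" "y \<notin> S" "(x, y) \<in> gE G"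
        using \<open>c \<in> S\<close> S(3) gconnected_cross[of G "set (b # q)" c S b] by auto
      moreover have "set (b # q) \<subseteq> gV G" "a \<notin> set (b # q)" using p by (auto simp: gpath_iff)
      ultimately show False using S(4)[of x y] by auto
    qed
    have "b' = b"
    proof (rule ccontr)
      assume "b' \<noteq> b"
      have av: "a \<in> gV G" "b' \<in> gV G" "(a, b') \<in> gE G" using p' p'e by (auto simp: gpath_iff)
      then have "b' \<in> S" using S(4)[of a b'] S(2) \<open>b' \<noteq> b\<close> by blast
      have "gconnected G (set (b' # r))"
        using gpath_connected[OF G(1), of "b' # r" b' c] gpath_suffix[of G "[a]" b' r a c] p' p'e by auto
      moreover have "c \<in> set (b' # r)"
        using p' p'e last_in_set[of "b' # r"] by (auto simp: gpath_iff)
      ultimately obtain x y where "x \<in> set (b' # r)" "x \<in> S" "y \<in> set (b' # r)" "y \<notin> S" "(x, y) \<in> gE G"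
        using \<open>b' \<in> S\<close> \<open>c \<notin> S\<close> gconnected_cross[of G "set (b' # r)" b' S c] by auto
      moreover have "set (b' # r) \<subseteq> gV G" "a \<notin> set (b' # r)" using p' p'e by (auto simp: gpath_iff)
      ultimately show False using S(4)[of x y] by auto
    qed
    then show ?thesis using p'e by simp
  qed
  have uniq: "gpath G p a c \<Longrightarrow> gpath G p' a c \<Longrightarrow> p = p'" for p p' a c
  proof (induction p arbitrary: a p')
    case Nil
    then show ?case by (simp add: gpath_iff)
  next
    case (Cons x q)
    then have [simp]: "x = a" by (simp add: gpath_iff)
    obtain q' where p'e: "p' = a # q'" using Cons by (cases p') (auto simp: gpath_iff)
    show ?case
    proof (cases q)
      case Nil
      then have "c = a" using Cons by (auto simp: gpath_iff)
      have "q' = []"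
      proof (rule ccontr)
        assume "q' \<noteq> []"
        then have "a \<in> set q'" using Cons(3) p'e \<open>c = a\<close> last_in_set[of q'] by (auto simp: gpath_iff)
        then show False using Cons(3) p'e by (auto simp: gpath_iff)
      qed
      then show ?thesis using Nil p'e by simp
    next
      case (Cons b r)
      then have "a \<noteq> c" using Cons.prems(1) last_in_set[of q] by (auto simp: gpath_iff)
      then obtain b' r' where q': "q' = b' # r'" using Cons.prems(2) p'e by (cases q') (auto simp: gpath_iff)
      have "a # b' # r' = a # b # r'" using start[of a b r c p' b' r'] Cons.prems Cons p'e q' by simp
      then have b: "p' = a # b # r'" using p'e q' by simp
      then have "gpath G (b # r) b c" "gpath G (b # r') b c"
        using gpath_suffix[of G "[a]" b r a c] gpath_suffix[of G "[a]" b r' a c] Cons.prems Cons by auto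
      then show ?thesis using Cons.IH[of b "b # r'"] Cons b by simp
    qed
  qed
  show ?thesis
    unfolding is_tree_def
  proof (intro conjI ballI impI ex_ex1I)
    fix a b assume "a \<in> gV G" "b \<in> gV G"
    then show "\<exists>p. gpath G p a b" using gconnected_imp_gpath[OF G(3)] by blast
  qed (use G uniq in blast)+
qed

lemma tree_is_graph: "is_tree G \<Longrightarrow> is_graph G"
  by (simp add: is_tree_def)

text \<open>The definition of a tree speaks of distinct ends only; for equal ends, the absence of
  repetitions leaves just the one-vertex path.\<close>

lemma tree_path_unique:
  assumes "is_tree G" "gpath G p a b" "gpath G q a b"
  shows "p = q"
proof (cases "a = b")
  case True
  have "r = [a]" if "gpath G r a b" for r
  proof -
    obtain r' where "r = a # r'" using \<open>gpath G r a b\<close> by (cases r) (auto simp: gpath_iff)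
    then show ?thesis using that True last_in_set[of r'] by (auto simp: gpath_iff split: if_splits)
  qed
  then show ?thesis using assms by metis
next
  case False
  moreover have "a \<in> gV G" "b \<in> gV G"
    using assms hd_in_set[of p] last_in_set[of p] by (auto simp: gpath_iff)
  ultimately show ?thesis using assms unfolding is_tree_def by blast
qed

lemma tree_path_exists:
  assumes "is_tree G" "a \<in> gV G" "b \<in> gV G"
  shows "\<exists>p. gpath G p a b"
proof (cases "a = b")
  case True
  then show ?thesis using gpath_single assms by blast
next
  case False
  then show ?thesis using assms unfolding is_tree_def by blast
qed

text \<open>Converse of \<open>tree_if_cuts\<close>. The side of \<open>a\<close> consists of the
  vertices that a path from \<open>a\<close> reaches without \<open>b\<close>. An edge leaving it
  can only end in \<open>b\<close>; prolonging the path by it must give the path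
  \<open>[a, b]\<close> by uniqueness, so the edge starts in \<open>a\<close>.\<close>

lemma tree_cut:
  assumes G: "is_tree G" and ab: "(a, b) \<in> gE G" "a \<noteq> b"
  shows "\<exists>S\<subseteq>gV G. a \<in> S \<and> b \<notin> S \<and> (\<forall>u\<in>S. \<forall>w\<in>gV G - S. (u, w) \<in> gE G \<longrightarrow> u = a \<and> w = b)"
proof -
  let ?S = "{w\<in>gV G. \<exists>p. gpath G p a w \<and> b \<notin> set p}"
  have V: "a \<in> gV G" "b \<in> gV G" using ab G by (auto simp: is_tree_def is_graph_def)
  show ?thesis
  proof (intro exI[of _ ?S] conjI ballI impI)
    have "gpath G [a] a a" by (rule gpath_single) fact
    then show "a \<in> ?S" using V ab by (auto intro!: exI[of _ "[a]"])
    show "b \<notin> ?S" using last_in_set by (auto simp: gpath_iff)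
    fix u w assume u: "u \<in> ?S" and w: "w \<in> gV G - ?S" and e: "(u, w) \<in> gE G"
    then obtain p where p: "gpath G p a u" "b \<notin> set p" by blast
    obtain q where q: "gpath G q a w" "set q \<subseteq> insert w (set p)"
      using gpath_step[OF p(1) e] w by blast
    have "b \<in> set q" using q w by blast
    then show wb: "w = b" using q p by blast
    have "gpath G (p @ [b]) a b" using gpath_snoc[OF p(1)] e wb V p by blast
    moreover have "gpath G [a, b] a b" using ab V by (auto simp: gpath_iff)
    ultimately have "p @ [b] = [a, b]" using tree_path_unique G by blast
    then show "u = a" using p by (auto simp: gpath_iff)
  qed blast
qed

text \<open>Being the least connected set that contains \<open>a\<close> and \<open>b\<close>, the vertex set of their path is
  transported along monotone maps without any reference to lists.\<close>

definition iv :: "fgraph \<Rightarrow> nat \<Rightarrow> nat \<Rightarrow> nat set" where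
  "iv G a b = set (THE p. gpath G p a b)"

lemma iv_eq: "is_tree G \<Longrightarrow> gpath G p a b \<Longrightarrow> iv G a b = set p"
  unfolding iv_def by (metis the_equality tree_path_unique)

context
  fixes G assumes G: "is_tree G"
begin

lemma iv_props:
  assumes "a \<in> gV G" "b \<in> gV G"
  shows iv_left: "a \<in> iv G a b" and iv_right: "b \<in> iv G a b" and iv_subset: "iv G a b \<subseteq> gV G"
    and iv_connected: "gconnected G (iv G a b)"
proof -
  obtain p where p: "gpath G p a b" using tree_path_exists G assms by blast
  then show "a \<in> iv G a b" "b \<in> iv G a b" "iv G a b \<subseteq> gV G" "gconnected G (iv G a b)"
    using iv_eq[OF G p] gpath_connected[OF tree_is_graph[OF G] p] by (auto simp: gpath_iff)
qed

lemma iv_least: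
  assumes "gconnected G S" "S \<subseteq> gV G" "a \<in> S" "b \<in> S"
  shows "iv G a b \<subseteq> S"
  using gconnected_imp_gpath[OF assms] iv_eq[OF G] by blast

lemma iv_commute: "a \<in> gV G \<Longrightarrow> b \<in> gV G \<Longrightarrow> iv G a b = iv G b a"
  by (simp add: iv_least iv_left iv_right iv_subset iv_connected subset_antisym)

lemma iv_mono:
  "a \<in> gV G \<Longrightarrow> b \<in> gV G \<Longrightarrow> c \<in> iv G a b \<Longrightarrow> d \<in> iv G a b \<Longrightarrow> iv G c d \<subseteq> iv G a b"
  by (simp add: iv_least iv_subset iv_connected)

lemma iv_split_Int:
  assumes "a \<in> gV G" "b \<in> gV G" "c \<in> iv G a b"
  shows "iv G a c \<inter> iv G c b = {c}"
proof -
  obtain p where p: "gpath G p a b" using tree_path_exists G assms by blast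
  then have "c \<in> set p" using assms iv_eq[OF G] by blast
  then obtain q r where pq: "p = q @ c # r" by (meson split_list)
  then have "gpath G (q @ [c]) a c" "gpath G (c # r) c b"
    using p gpath_prefix gpath_suffix by blast+
  moreover have "distinct p" using p by (simp add: gpath_iff)
  ultimately show ?thesis using iv_eq[OF G] pq by auto
qed

lemma iv_split_Un:
  assumes "a \<in> gV G" "b \<in> gV G" "c \<in> iv G a b"
  shows "iv G a c \<union> iv G c b = iv G a b"
proof
  have c: "c \<in> gV G" using assms iv_subset by blast
  show "iv G a c \<union> iv G c b \<subseteq> iv G a b"
    using assms by (simp add: iv_mono iv_left iv_right)
  have "gconnected G (iv G a c \<union> iv G c b)"
    using assms c iv_left[of c b] iv_right[of a c] by (intro gconnected_Un iv_connected) auto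
  then show "iv G a b \<subseteq> iv G a c \<union> iv G c b"
    using assms c iv_subset iv_left iv_right by (intro iv_least) auto
qed

text \<open>Two paths that meet only in \<open>c\<close> concatenate to a path, which by uniqueness
  is the one from \<open>a\<close> to \<open>b\<close>.\<close>

lemma iv_join:
  assumes "a \<in> gV G" "b \<in> gV G" "c \<in> gV G" "iv G a c \<inter> iv G c b \<subseteq> {c}"
  shows "c \<in> iv G a b"
proof -
  obtain p q where p: "gpath G p a c" and q: "gpath G q c b" using tree_path_exists G assms by blast
  then have "gpath G (p @ tl q) a b" using assms iv_eq[OF G] gpath_concat by metis
  then have "iv G a b = set (p @ tl q)" using iv_eq[OF G] by blast
  then show ?thesis using p last_in_set[of p] by (auto simp: gpath_iff)
qed

text \<open>Together with \<open>iv_mono\<close> and \<open>iv_antisym\<close> this makes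
  \<open>c \<in> iv G a d\<close> a linear order on the path from \<open>a\<close> to
  \<open>b\<close>.\<close>

lemma iv_linear:
  assumes "a \<in> gV G" "b \<in> gV G" "c \<in> iv G a b" "d \<in> iv G a b"
  shows "c \<in> iv G a d \<or> d \<in> iv G a c"
proof (cases "c \<in> iv G a d")
  case False
  have cd: "c \<in> gV G" "d \<in> gV G" using assms iv_subset by blast+
  have "c \<in> iv G d b" using False iv_split_Un[OF assms(1,2,4)] assms by blast
  then have "iv G d c \<subseteq> iv G d b" using iv_mono iv_left assms cd by blast
  then have "iv G a d \<inter> iv G d c \<subseteq> {d}" using iv_split_Int[OF assms(1,2,4)] by blast
  then show ?thesis using iv_join assms cd by blast
qed simp

lemma iv_antisym:
  assumes "a \<in> gV G" "c \<in> gV G" "d \<in> gV G" "c \<in> iv G a d" "d \<in> iv G a c"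
  shows "c = d"
proof -
  have "iv G a c \<inter> iv G c d = {c}" using iv_split_Int assms by blast
  moreover have "d \<in> iv G c d" using assms iv_right by simp
  ultimately show ?thesis using assms(5) by (metis IntI singletonD)
qed

lemma iv_trans:
  assumes "a \<in> gV G" "b \<in> gV G" "c \<in> iv G a b" "d \<in> iv G a c"
  shows "d \<in> iv G a b" "c \<in> iv G d b"
proof -
  have c: "c \<in> gV G" using assms iv_subset by blast
  have d: "d \<in> gV G" using assms c iv_subset by blast
  show "d \<in> iv G a b" using iv_split_Un assms by blast
  have "iv G c d \<subseteq> iv G a c" using iv_mono[OF assms(1) c iv_right[OF assms(1) c] assms(4)] .
  then have "iv G d c \<inter> iv G c b \<subseteq> {c}"
    using iv_split_Int[OF assms(1-3)] iv_commute[OF c d] by blast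
  then show "c \<in> iv G d b" using iv_join assms c d by blast
qed

text \<open>The median is the gate of \<open>c\<close> on the path from \<open>a\<close> to
  \<open>b\<close>: the vertex \<open>m\<close> of that path with the smallest interval to
  \<open>c\<close>. Minimality makes this interval meet the path in \<open>m\<close> alone, so it
  concatenates with both halves of the path.\<close>

lemma iv_median:
  assumes V: "a \<in> gV G" "b \<in> gV G" "c \<in> gV G"
  shows "iv G a b \<inter> iv G b c \<inter> iv G a c \<noteq> {}"
proof -
  obtain m where m: "m \<in> iv G a b" and least: "\<And>x. x \<in> iv G a b \<Longrightarrow> card (iv G c m) \<le> card (iv G c x)"
    using ex_has_least_nat[of "\<lambda>x. x \<in> iv G a b" a "\<lambda>x. card (iv G c x)"] iv_left[OF V(1,2)] by blast
  have Vm: "m \<in> gV G" using m iv_subset[OF V(1,2)] by blast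
  have gate: "iv G c m \<inter> iv G a b \<subseteq> {m}"
  proof
    fix x assume x: "x \<in> iv G c m \<inter> iv G a b"
    then have Vx: "x \<in> gV G" using iv_subset[OF V(1,2)] by blast
    have "iv G c x \<subseteq> iv G c m" using x iv_mono[OF V(3) Vm iv_left[OF V(3) Vm]] by blast
    moreover have "finite (iv G c m)"
      using finite_subset[OF iv_subset[OF V(3) Vm]] G by (simp add: is_tree_def)
    ultimately have "iv G c x = iv G c m" using least[of x] x card_seteq by blast
    then have "m \<in> iv G c x" using iv_right[OF V(3) Vm] by simp
    then show "x \<in> {m}" using iv_antisym[OF V(3) Vx Vm] x by simp
  qed
  have "m \<in> iv G c a"
    using gate iv_mono[OF V(1,2) m iv_left[OF V(1,2)]] by (intro iv_join[OF V(3,1) Vm]) blast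
  moreover have "m \<in> iv G c b"
    using gate iv_mono[OF V(1,2) m iv_right[OF V(1,2)]] by (intro iv_join[OF V(3,2) Vm]) blast
  ultimately have "m \<in> iv G a b \<inter> iv G b c \<inter> iv G a c"
    using m iv_commute[OF V(2,3)] iv_commute[OF V(1,3)] by simp
  then show ?thesis by blast
qed

lemma iv_edge: "(a, b) \<in> gE G \<Longrightarrow> iv G a b = {a, b}"
proof -
  assume e: "(a, b) \<in> gE G"
  have "a \<in> gV G" "b \<in> gV G" using e G by (auto simp: is_tree_def is_graph_def)
  then show ?thesis
    using iv_least[OF gconnected_edge[OF tree_is_graph[OF G] e]] iv_left[of a b] iv_right[of a b] by auto
qed

text \<open>A connected set in a tree contains the interval between any two of its points, so the
  intersection is a star of intervals about any of its points.\<close>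

lemma gconnected_Int:
  assumes "gconnected G S" "gconnected G T" "S \<subseteq> gV G" "T \<subseteq> gV G"
  shows "gconnected G (S \<inter> T)"
proof (cases "S \<inter> T = {}")
  case False
  then obtain a where a: "a \<in> S \<inter> T" by blast
  then show ?thesis
    using assms iv_least[of S a] iv_least[of T a] iv_left[of a] iv_right[of a] iv_connected[of a]
    by (intro gconnected_star[of a]) (meson Int_iff le_infI subsetD)+
qed simp

lemma tree_connected: "gconnected G (gV G)"
proof (cases "gV G = {}")
  case False
  then obtain a where "a \<in> gV G" by blast
  then show ?thesis by (intro gconnected_star[of a]) (meson iv_subset iv_left iv_right iv_connected)+
qed simp

end

section \<open>Monotone maps and elementary refinements of trees\<close>

text \<open>Reduces monotonicity to the fibres of single vertices. A part without outgoing edges is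
  a union of whole fibres, since these are connected; its image is then a part of \<open>S\<close>
  without outgoing edges, since edges lift.\<close>

lemma gconnected_preimage:
  assumes fib: "\<And>y. y \<in> S \<Longrightarrow> gconnected B {x\<in>gV B. f x = y}"
    and lift: "\<And>a b. (a, b) \<in> gE A \<Longrightarrow> \<exists>x\<in>gV B. \<exists>y\<in>gV B. (x, y) \<in> gE B \<and> f x = a \<and> f y = b"
    and S: "gconnected A S"
  shows "gconnected B {x\<in>gV B. f x \<in> S}"
proof (rule gconnectedI)
  let ?U = "{x\<in>gV B. f x \<in> S}"
  fix P assume P: "P \<subseteq> ?U" "P \<noteq> {}" "\<And>x y. x \<in> P \<Longrightarrow> y \<in> ?U - P \<Longrightarrow> (x, y) \<notin> gE B"
  have full: "z \<in> P" if xz: "x \<in> P" "z \<in> gV B" "f z = f x" for x z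
  proof (rule ccontr)
    assume "z \<notin> P"
    have "f x \<in> S" using P(1) xz by auto
    moreover have "x \<in> gV B" using P(1) xz by auto
    ultimately obtain u w where "u \<in> P" "w \<in> gV B" "f w = f x" "w \<notin> P" "(u, w) \<in> gE B"
      using xz \<open>z \<notin> P\<close> by (elim gconnected_cross[OF fib, of "f x" x P z]) auto
    then show False using P(3)[of u w] \<open>f x \<in> S\<close> by auto
  qed
  have fP: "f ` P = S"
  proof (rule gconnectedD[OF S])
    fix a b assume a: "a \<in> f ` P" and b: "b \<in> S - f ` P"
    show "(a, b) \<notin> gE A"
    proof
      assume "(a, b) \<in> gE A"
      then obtain x y where xy: "x \<in> gV B" "y \<in> gV B" "(x, y) \<in> gE B" "f x = a" "f y = b"
        using lift by meson
      obtain x0 where "x0 \<in> P" "a = f x0" using a by blast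
      then have "x \<in> P" using full xy by simp
      moreover have "y \<in> ?U - P" using xy b by auto
      ultimately show False using P(3) xy by blast
    qed
  qed (use P in auto)
  show "P = ?U"
  proof
    show "?U \<subseteq> P"
    proof
      fix z assume z: "z \<in> ?U"
      then obtain x0 where "x0 \<in> P" "f z = f x0" using fP by blast
      then show "z \<in> P" using full z by simp
    qed
  qed (rule P)
qed

lemma tm3_morD:
  assumes "tm3_mor A B f"
  shows tm3_mor_obj: "tm3_obj A" "tm3_obj B"
    and tm3_mor_tree: "is_tree A" "is_tree B"
    and tm3_mor_in: "x \<in> gV A \<Longrightarrow> f x \<in> gV B"
    and tm3_mor_edge: "(x, y) \<in> gE A \<Longrightarrow> (f x, f y) \<in> gE B"
    and tm3_mor_surj: "f ` gV A = gV B"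
    and tm3_mor_edge_surj: "(\<lambda>(x, y). (f x, f y)) ` gE A = gE B"
    and tm3_mor_preimage: "S \<subseteq> gV B \<Longrightarrow> gconnected B S \<Longrightarrow> gconnected A {x\<in>gV A. f x \<in> S}"
  using assms unfolding tm3_mor_def tm3_obj_def gepi_def gmonotone_def by blast+

lemma tm3_mor_id:
  assumes "tm3_obj A"
  shows "tm3_mor A A (\<lambda>x. x)"
proof -
  have "{x \<in> gV A. x \<in> S} = S" if "S \<subseteq> gV A" for S using that by blast
  then show ?thesis using assms by (auto simp: tm3_mor_def gepi_def gmonotone_def)
qed

lemma tm3_mor_comp:
  assumes f: "tm3_mor A B f" and g: "tm3_mor B C g"
  shows "tm3_mor A C (\<lambda>x. g (f x))"
  unfolding tm3_mor_def gepi_def gmonotone_def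
proof (intro conjI allI impI ballI)
  show "(\<lambda>x. g (f x)) ` gV A = gV C"
    using tm3_mor_surj[OF f] tm3_mor_surj[OF g] by (metis image_image)
  have "(\<lambda>(x, y). (g (f x), g (f y))) ` gE A = (\<lambda>(x, y). (g x, g y)) ` (\<lambda>(x, y). (f x, f y)) ` gE A"
    by (auto simp: image_image case_prod_beta)
  then show "(\<lambda>(x, y). (g (f x), g (f y))) ` gE A = gE C"
    using tm3_mor_edge_surj[OF f] tm3_mor_edge_surj[OF g] by simp
  fix S assume S: "S \<subseteq> gV C" "gconnected C S"
  have "gconnected A {x \<in> gV A. f x \<in> {y \<in> gV B. g y \<in> S}}"
    using tm3_mor_preimage[OF g S] by (intro tm3_mor_preimage[OF f]) auto
  moreover have "{x \<in> gV A. f x \<in> {y \<in> gV B. g y \<in> S}} = {x \<in> gV A. g (f x) \<in> S}"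
    using tm3_mor_in[OF f] by auto
  ultimately show "gconnected A {x \<in> gV A. g (f x) \<in> S}" by simp
qed (use tm3_morD[OF f] tm3_morD[OF g] in auto)

lemma tm3_mor_image_connected:
  "tm3_mor A B f \<Longrightarrow> gconnected A S \<Longrightarrow> gconnected B (f ` S)"
  using gconnected_image[of A S f B] tm3_mor_edge by blast

text \<open>By monotonicity the preimage of the interval below is connected, and the interval above
  is the least connected set containing its ends.\<close>

lemma tm3_mor_iv:
  assumes f: "tm3_mor A B f" and V: "a \<in> gV A" "b \<in> gV A" and c: "c \<in> iv A a b"
  shows "f c \<in> iv B (f a) (f b)"
proof -
  note T = tm3_mor_tree[OF f] and i = tm3_mor_in[OF f]
  have "iv A a b \<subseteq> {x \<in> gV A. f x \<in> iv B (f a) (f b)}"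
    using V i by (intro iv_least[OF T(1)] tm3_mor_preimage[OF f] iv_connected[OF T(2)] iv_subset[OF T(2)])
      (auto intro: iv_left[OF T(2)] iv_right[OF T(2)])
  then show ?thesis using c by auto
qed

text \<open>The reverse inclusion: the image of the interval above is connected and contains both
  ends of the interval below.\<close>

lemma tm3_mor_iv_onto:
  assumes f: "tm3_mor A B f" and V: "a \<in> gV A" "b \<in> gV A" and c: "c \<in> iv B (f a) (f b)"
  obtains d where "d \<in> iv A a b" "f d = c"
proof -
  note T = tm3_mor_tree[OF f] and i = tm3_mor_in[OF f]
  have "iv B (f a) (f b) \<subseteq> f ` iv A a b"
    using V i iv_subset[OF T(1) V] iv_left[OF T(1) V] iv_right[OF T(1) V]
    by (intro iv_least[OF T(2)] tm3_mor_image_connected[OF f] iv_connected[OF T(1)]) auto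
  then show thesis using that c by auto
qed

lemma vorder_le:
  assumes "{x. x \<noteq> u \<and> (u, x) \<in> gE G} \<subseteq> N" "finite N" "card N \<le> k"
  shows "vorder G u \<le> k"
  unfolding vorder_def using assms card_mono le_trans by blast

section \<open>Refining a tree by a new leaf or by subdividing an edge\<close>

definition collapse :: "nat \<Rightarrow> nat \<Rightarrow> nat \<Rightarrow> nat" where
  "collapse v e x = (if x = e then v else x)"

lemma collapse_simps [simp]: "collapse v e e = v" "x \<noteq> e \<Longrightarrow> collapse v e x = x"
  by (simp_all add: collapse_def)

text \<open>What the two refinements share. The fibre of \<open>v\<close> is the edge from
  \<open>v\<close> to \<open>e\<close>, all others are single vertices, so
  \<open>gconnected_preimage\<close> gives monotonicity; applied to all of \<open>A\<close> it makes
  \<open>B\<close> connected, and the cuts make it a tree.\<close>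

lemma collapse_tm3_mor:
  assumes A: "tm3_obj A" and v: "v \<in> gV A" and e: "e \<notin> gV A"
    and B: "is_graph B" "gV B = insert e (gV A)" "(v, e) \<in> gE B"
    and push: "\<And>x y. (x, y) \<in> gE B \<Longrightarrow> (collapse v e x, collapse v e y) \<in> gE A"
    and lift: "\<And>a b. (a, b) \<in> gE A \<Longrightarrow> \<exists>x\<in>gV B. \<exists>y\<in>gV B. (x, y) \<in> gE B \<and> collapse v e x = a \<and> collapse v e y = b"
    and cut: "\<And>a b. (a, b) \<in> gE B \<Longrightarrow> a \<noteq> b \<Longrightarrow>
      \<exists>S\<subseteq>gV B. a \<in> S \<and> b \<notin> S \<and> (\<forall>u\<in>S. \<forall>w\<in>gV B - S. (u, w) \<in> gE B \<longrightarrow> u = a \<and> w = b)"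
    and ord: "\<And>u. u \<in> gV B \<Longrightarrow> vorder B u \<le> 3"
  shows "tm3_mor B A (collapse v e)"
proof -
  have At: "is_tree A" using A by (simp add: tm3_obj_def)
  have finA: "finite (gV A)" using At by (simp add: is_tree_def)
  have fib: "gconnected B {x\<in>gV B. collapse v e x = y}" if "y \<in> gV A" for y
  proof (cases "y = v")
    case True
    then have "{x\<in>gV B. collapse v e x = y} = {v, e}" using v e B(2) by (auto simp: collapse_def)
    then show ?thesis using gconnected_edge[OF B(1,3)] by simp
  next
    case False
    then have "{x\<in>gV B. collapse v e x = y} = {y}" using that e B(2) by (auto simp: collapse_def)
    then show ?thesis by simp
  qed
  have mono: "gconnected B {x\<in>gV B. collapse v e x \<in> S}" if "S \<subseteq> gV A" "gconnected A S" for S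
    using that by (intro gconnected_preimage[OF _ lift] fib) auto
  have "{x\<in>gV B. collapse v e x \<in> gV A} = gV B" using v B(2) by (auto simp: collapse_def)
  then have "gconnected B (gV B)" using mono[OF _ tree_connected[OF At]] by simp
  then have "is_tree B" using B finA cut by (intro tree_if_cuts) auto
  moreover have "2 \<le> card (gV B)" using A finA e by (simp add: B(2) tm3_obj_def)
  ultimately have objB: "tm3_obj B" using ord by (simp add: tm3_obj_def)
  have "collapse v e ` gV B = gV A"
    using v e by (auto simp: B(2) collapse_def image_iff)
  moreover have "(\<lambda>(x, y). (collapse v e x, collapse v e y)) ` gE B = gE A"
    using push lift by (auto simp: image_iff) (metis (no_types, lifting) case_prod_conv)
  ultimately show ?thesis
    using A objB push mono by (auto simp: tm3_mor_def gepi_def gmonotone_def)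
qed

definition add_leaf :: "fgraph \<Rightarrow> nat \<Rightarrow> nat \<Rightarrow> fgraph" where
  "add_leaf G v e = \<lparr>gV = insert e (gV G), gE = gE G \<union> {(e, e), (v, e), (e, v)}\<rparr>"

definition subdiv :: "fgraph \<Rightarrow> nat \<Rightarrow> nat \<Rightarrow> nat \<Rightarrow> fgraph" where
  "subdiv G v w e = \<lparr>gV = insert e (gV G),
     gE = gE G - {(v, w), (w, v)} \<union> {(e, e), (v, e), (e, v), (e, w), (w, e)}\<rparr>"

lemma add_leaf_simps [simp]:
  "gV (add_leaf G v e) = insert e (gV G)"
  "gE (add_leaf G v e) = gE G \<union> {(e, e), (v, e), (e, v)}"
  by (simp_all add: add_leaf_def)

lemma subdiv_simps [simp]:
  "gV (subdiv G v w e) = insert e (gV G)"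
  "gE (subdiv G v w e) = gE G - {(v, w), (w, v)} \<union> {(e, e), (v, e), (e, v), (e, w), (w, e)}"
  by (simp_all add: subdiv_def)

lemma finite_neighbours:
  assumes "is_graph G" "finite (gV G)"
  shows "finite {x. x \<noteq> u \<and> (u, x) \<in> gE G}"
  by (rule finite_subset[OF _ assms(2)]) (use assms(1) in \<open>auto simp: is_graph_def\<close>)

lemma add_leaf_tm3_mor:
  assumes A: "tm3_obj A" and v: "v \<in> gV A" "vorder A v \<le> 2" and e: "e \<notin> gV A"
  shows "tm3_mor (add_leaf A v e) A (collapse v e)"
proof -
  let ?B = "add_leaf A v e"
  have At: "is_tree A" and ordA: "\<And>u. u \<in> gV A \<Longrightarrow> vorder A u \<le> 3" using A by (auto simp: tm3_obj_def)
  have gr: "is_graph A" and fin: "finite (gV A)" using At by (auto simp: is_tree_def)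
  have E: "\<And>x y. (x, y) \<in> gE A \<Longrightarrow> x \<in> gV A \<and> y \<in> gV A \<and> x \<noteq> e \<and> y \<noteq> e"
    and sym: "\<And>x y. (x, y) \<in> gE A \<Longrightarrow> (y, x) \<in> gE A"
    and R: "\<And>x. x \<in> gV A \<Longrightarrow> (x, x) \<in> gE A"
    using gr e by (auto simp: is_graph_def)
  show ?thesis
  proof (rule collapse_tm3_mor[OF A v(1) e])
    show "is_graph ?B" using R v by (auto simp: is_graph_def dest: E sym)
    show "(collapse v e x, collapse v e y) \<in> gE A" if "(x, y) \<in> gE ?B" for x y
      using that R v by (auto simp: collapse_def dest: E)
    show "\<exists>x\<in>gV ?B. \<exists>y\<in>gV ?B. (x, y) \<in> gE ?B \<and> collapse v e x = a \<and> collapse v e y = b"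
      if "(a, b) \<in> gE A" for a b
      using that E[OF that] by (intro bexI[of _ a] bexI[of _ b]) auto
    show "vorder ?B u \<le> 3" if u: "u \<in> gV ?B" for u
    proof (cases "u = e")
      case True
      have "{x. x \<noteq> u \<and> (u, x) \<in> gE ?B} \<subseteq> {v}" using True by (auto dest: E)
      then show ?thesis by (rule vorder_le) auto
    next
      case False
      then have "u \<in> gV A" using u by simp
      let ?N = "{x. x \<noteq> u \<and> (u, x) \<in> gE A}"
      show ?thesis
      proof (cases "u = v")
        case True
        have "{x. x \<noteq> u \<and> (u, x) \<in> gE ?B} \<subseteq> insert e ?N" using False by auto
        moreover have "card (insert e ?N) \<le> 3"
          using True v(2) finite_neighbours[OF gr fin, of u] by (simp add: vorder_def card_insert_if)
        ultimately show ?thesis using finite_neighbours[OF gr fin, of u] by (intro vorder_le) auto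
      next
        case nv: False
        have "{x. x \<noteq> u \<and> (u, x) \<in> gE ?B} \<subseteq> ?N" using False nv by auto
        then show ?thesis
          using finite_neighbours[OF gr fin, of u] ordA[OF \<open>u \<in> gV A\<close>]
          by (intro vorder_le) (auto simp: vorder_def)
      qed
    qed
    fix a b assume ab: "(a, b) \<in> gE ?B" "a \<noteq> b"
    show "\<exists>S\<subseteq>gV ?B. a \<in> S \<and> b \<notin> S \<and> (\<forall>u\<in>S. \<forall>w\<in>gV ?B - S. (u, w) \<in> gE ?B \<longrightarrow> u = a \<and> w = b)"
    proof -
      \<comment> \<open>A cut of \<open>A\<close> becomes a cut of the new tree once
        \<open>e\<close> is put on the side of \<open>v\<close>; the new edge cuts off the leaf
        alone.\<close>
      consider "(a, b) \<in> gE A" | "a = v" "b = e" | "a = e" "b = v" using ab by auto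
      then show ?thesis
      proof cases
        case 1
        then obtain S where S: "S \<subseteq> gV A" "a \<in> S" "b \<notin> S"
          "\<And>u w. u \<in> S \<Longrightarrow> w \<in> gV A - S \<Longrightarrow> (u, w) \<in> gE A \<Longrightarrow> u = a \<and> w = b"
          using tree_cut[OF At 1 ab(2)] by meson
        have S': "\<And>u w. u \<in> S \<Longrightarrow> w \<notin> S \<Longrightarrow> (u, w) \<in> gE A \<Longrightarrow> u = a \<and> w = b" using S(4) by (auto dest: E)
        show ?thesis
        proof (cases "v \<in> S")
          case True
          show ?thesis
            by (rule exI[of _ "insert e S"]) (use S(1-3) E[OF 1] True in \<open>auto dest: E S'\<close>)
        next
          case False
          show ?thesis
            by (rule exI[of _ S]) (use S(1-3) False e in \<open>auto dest: E S'\<close>)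
        qed
      next
        case 2
        show ?thesis by (rule exI[of _ "gV A"]) (use 2 v e in \<open>auto dest: E\<close>)
      next
        case 3
        show ?thesis by (rule exI[of _ "{e}"]) (use 3 v e in \<open>auto dest: E\<close>)
      qed
    qed
  qed (use v in auto)
qed

lemma subdiv_tm3_mor:
  assumes A: "tm3_obj A" and vw: "(v, w) \<in> gE A" "v \<noteq> w" and e: "e \<notin> gV A"
  shows "tm3_mor (subdiv A v w e) A (collapse v e)"
proof -
  let ?B = "subdiv A v w e"
  have At: "is_tree A" and ordA: "\<And>u. u \<in> gV A \<Longrightarrow> vorder A u \<le> 3" using A by (auto simp: tm3_obj_def)
  have gr: "is_graph A" and fin: "finite (gV A)" using At by (auto simp: is_tree_def)
  have E: "\<And>x y. (x, y) \<in> gE A \<Longrightarrow> x \<in> gV A \<and> y \<in> gV A \<and> x \<noteq> e \<and> y \<noteq> e"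
    and sym: "\<And>x y. (x, y) \<in> gE A \<Longrightarrow> (y, x) \<in> gE A"
    and R: "\<And>x. x \<in> gV A \<Longrightarrow> (x, x) \<in> gE A"
    using gr e by (auto simp: is_graph_def)
  have v: "v \<in> gV A" "w \<in> gV A" "(w, v) \<in> gE A" "v \<noteq> e" "w \<noteq> e" using E[OF vw(1)] sym[OF vw(1)] by auto
  show ?thesis
  proof (rule collapse_tm3_mor[OF A v(1) e])
    show "is_graph ?B" using R v vw by (auto simp: is_graph_def dest: E sym)
    show "(collapse v e x, collapse v e y) \<in> gE A" if "(x, y) \<in> gE ?B" for x y
      using that R v vw by (auto simp: collapse_def dest: E)
    show "\<exists>x\<in>gV ?B. \<exists>y\<in>gV ?B. (x, y) \<in> gE ?B \<and> collapse v e x = a \<and> collapse v e y = b"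
      if "(a, b) \<in> gE A" for a b
    proof -
      consider "a = v" "b = w" | "a = w" "b = v" | "(a, b) \<notin> {(v, w), (w, v)}" by auto
      then show ?thesis
      proof cases
        case 1
        then show ?thesis using v by (intro bexI[of _ e] bexI[of _ w]) auto
      next
        case 2
        then show ?thesis using v by (intro bexI[of _ w] bexI[of _ e]) auto
      next
        case 3
        then show ?thesis using that E[OF that] by (intro bexI[of _ a] bexI[of _ b]) auto
      qed
    qed
    show "vorder ?B u \<le> 3" if u: "u \<in> gV ?B" for u
    proof (cases "u = e")
      case True
      have "{x. x \<noteq> u \<and> (u, x) \<in> gE ?B} \<subseteq> {v, w}" using True by (auto dest: E)
      then show ?thesis by (rule vorder_le) (auto simp: card_insert_if)
    next
      case False
      then have "u \<in> gV A" using u by simp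
      let ?N = "{x. x \<noteq> u \<and> (u, x) \<in> gE A}"
      have fN: "finite ?N" and cN: "card ?N \<le> 3"
        using finite_neighbours[OF gr fin, of u] ordA[OF \<open>u \<in> gV A\<close>] by (auto simp: vorder_def)
      \<comment> \<open>An end of the subdivided edge exchanges its old neighbour \<open>y\<close>
        for \<open>e\<close>, so its order does not grow.\<close>
      have replace: ?thesis
        if "{x. x \<noteq> u \<and> (u, x) \<in> gE ?B} \<subseteq> insert e (?N - {y})" "y \<in> ?N" for y
      proof (rule vorder_le[OF that(1)])
        have "card (?N - {y}) = card ?N - 1" using that(2) fN by simp
        moreover have "card ?N > 0" using that(2) fN card_gt_0_iff by blast
        ultimately show "card (insert e (?N - {y})) \<le> 3" using fN cN by (auto simp: card_insert_if)
      qed (use fN in simp)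
      consider "u = v" | "u = w" | "u \<noteq> v" "u \<noteq> w" by blast
      then show ?thesis
      proof cases
        case 1
        show ?thesis by (rule replace[of w]) (use 1 vw v in auto)
      next
        case 2
        show ?thesis by (rule replace[of v]) (use 2 vw v in auto)
      next
        case 3
        have "{x. x \<noteq> u \<and> (u, x) \<in> gE ?B} \<subseteq> ?N" using False 3 by auto
        then show ?thesis using fN cN by (rule vorder_le)
      qed
    qed
    fix a b assume ab: "(a, b) \<in> gE ?B" "a \<noteq> b"
    show "\<exists>S\<subseteq>gV ?B. a \<in> S \<and> b \<notin> S \<and> (\<forall>u\<in>S. \<forall>w\<in>gV ?B - S. (u, w) \<in> gE ?B \<longrightarrow> u = a \<and> w = b)"
    proof -
      have cutA: "\<exists>S. S \<subseteq> gV A \<and> c \<in> S \<and> d \<notin> S \<and> e \<notin> S \<and>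
          (\<forall>u w. u \<in> S \<longrightarrow> w \<notin> S \<longrightarrow> (u, w) \<in> gE A \<longrightarrow> u = c \<and> w = d)"
        if cd: "(c, d) \<in> gE A" "c \<noteq> d" for c d
      proof -
        obtain S where "S \<subseteq> gV A" "c \<in> S" "d \<notin> S"
          "\<And>u w. u \<in> S \<Longrightarrow> w \<in> gV A - S \<Longrightarrow> (u, w) \<in> gE A \<Longrightarrow> u = c \<and> w = d"
          using tree_cut[OF At cd] by meson
        then show ?thesis using e by (intro exI[of _ S]) (auto dest: E)
      qed
      \<comment> \<open>\<open>S\<close> and \<open>T\<close> are the two sides of the removed edge,
        as seen from \<open>v\<close> and from \<open>w\<close>; with or without \<open>e\<close>
        added, they are the cuts of the two new edges in both directions.\<close>
      obtain S where S: "S \<subseteq> gV A" "v \<in> S" "w \<notin> S" "e \<notin> S"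
          "\<And>u x. u \<in> S \<Longrightarrow> x \<notin> S \<Longrightarrow> (u, x) \<in> gE A \<Longrightarrow> u = v \<and> x = w"
        using cutA[OF vw] by blast
      obtain T where T: "T \<subseteq> gV A" "w \<in> T" "v \<notin> T" "e \<notin> T"
          "\<And>u x. u \<in> T \<Longrightarrow> x \<notin> T \<Longrightarrow> (u, x) \<in> gE A \<Longrightarrow> u = w \<and> x = v"
        using cutA[OF v(3)] vw(2) by blast
      consider "(a, b) \<in> gE A" "(a, b) \<notin> {(v, w), (w, v)}" | "a = v" "b = e" | "a = e" "b = v"
        | "a = w" "b = e" | "a = e" "b = w" using ab by auto
      then show ?thesis
      proof cases
        case 1
        obtain U where U: "U \<subseteq> gV A" "a \<in> U" "b \<notin> U" "e \<notin> U"
          "\<And>u x. u \<in> U \<Longrightarrow> x \<notin> U \<Longrightarrow> (u, x) \<in> gE A \<Longrightarrow> u = a \<and> x = b"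
          using cutA[OF 1(1) ab(2)] by blast
        \<comment> \<open>Only the edge from \<open>a\<close> to \<open>b\<close> leaves
          \<open>U\<close>, so both ends of the subdivided edge lie on the same side, and
          \<open>e\<close> is put there as well.\<close>
        have side: "v \<in> U \<longleftrightarrow> w \<in> U" using U(5)[of v w] U(5)[of w v] vw v 1(2) by blast
        show ?thesis
        proof (cases "v \<in> U")
          case True
          show ?thesis
            by (rule exI[of _ "insert e U"]) (use U(1-4) side True E[OF 1(1)] in \<open>auto dest: E U(5)\<close>)
        next
          case False
          show ?thesis
            by (rule exI[of _ U]) (use U(1-4) side False in \<open>auto dest: E U(5)\<close>)
        qed
      next
        case 2
        show ?thesis by (rule exI[of _ S]) (use 2 S(1-4) v in \<open>auto dest: E S(5)\<close>)
      next
        case 3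
        show ?thesis by (rule exI[of _ "insert e T"]) (use 3 T(1-4) v in \<open>auto dest: E T(5)\<close>)
      next
        case 4
        show ?thesis by (rule exI[of _ T]) (use 4 T(1-4) v in \<open>auto dest: E T(5)\<close>)
      next
        case 5
        show ?thesis by (rule exI[of _ "insert e S"]) (use 5 S(1-4) v in \<open>auto dest: E S(5)\<close>)
      qed
    qed
  qed (use v in auto)
qed

lemma gconnected_two_edges:
  assumes "is_graph G" "(a, b) \<in> gE G" "(b, c) \<in> gE G"
  shows "gconnected G {a, b, c}"
proof -
  have "gconnected G ({a, b} \<union> {b, c})"
    using gconnected_edge[OF assms(1)] assms by (intro gconnected_Un) auto
  then show ?thesis by (simp add: insert_commute)
qed

lemma tm3_neighbour:
  assumes "tm3_obj A" "v \<in> gV A"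
  obtains w where "(v, w) \<in> gE A" "v \<noteq> w"
proof -
  have At: "is_tree A" "2 \<le> card (gV A)" using assms by (auto simp: tm3_obj_def)
  have "\<not> gV A \<subseteq> {v}"
    using At(2) card_mono[of "{v}" "gV A"] by auto
  then obtain u where "u \<in> gV A" "u \<noteq> v" by blast
  then show thesis
    using gconnected_cross[OF tree_connected[OF At(1)] assms(2), of "{v}" u] that by auto
qed

text \<open>As \<open>v\<close> may already have order 3, the centre of the tripod is the vertex
  \<open>e\<close> put on an edge from \<open>v\<close> to \<open>w\<close>: it has order 2 and
  takes a third leg through \<open>s\<close> to \<open>t\<close>. Subdividing at \<open>b\<close>
  and \<open>c\<close> the edges from \<open>e\<close> to \<open>v\<close> and to \<open>w\<close>
  places all three ends \<open>v\<close>, \<open>w\<close>, \<open>t\<close> at distance two from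
  \<open>e\<close>. All new vertices are collapsed to \<open>v\<close>.\<close>

lemma tripod:
  assumes A: "tm3_obj A" and v: "v \<in> gV A"
  shows "\<exists>B g c d1 d2 d3 L1 L2 L3. tm3_mor B A g \<and> c \<in> gV B \<and> g c = v
    \<and> (\<forall>(d, L) \<in> {(d1, L1), (d2, L2), (d3, L3)}.
         L \<subseteq> gV B \<and> gconnected B L \<and> c \<in> L \<and> d \<in> L \<and> (c, d) \<notin> gE B)
    \<and> L1 \<inter> L2 = {c} \<and> L1 \<inter> L3 = {c} \<and> L2 \<inter> L3 = {c}"
proof -
  have At: "is_tree A" using A by (simp add: tm3_obj_def)
  then have E: "\<And>x y. (x, y) \<in> gE A \<Longrightarrow> x \<in> gV A \<and> y \<in> gV A"
    and fin: "finite (gV A)" by (auto simp: is_tree_def is_graph_def)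
  obtain w where vw: "(v, w) \<in> gE A" "v \<noteq> w" using tm3_neighbour assms by blast
  have new: "\<exists>x. x \<notin> S" if "finite S" for S :: "nat set" using that ex_new_if_finite by blast
  obtain e where e: "e \<notin> gV A" using new fin by blast
  obtain s where s: "s \<notin> insert e (gV A)" using new fin by (meson finite_insert)
  obtain t where t: "t \<notin> insert s (insert e (gV A))" using new fin by (meson finite_insert)
  obtain b where b: "b \<notin> insert t (insert s (insert e (gV A)))" using new fin by (meson finite_insert)
  obtain c where c: "c \<notin> insert b (insert t (insert s (insert e (gV A))))"
    using new fin by (meson finite_insert)
  define G1 where "G1 = subdiv A v w e"
  define G2 where "G2 = add_leaf G1 e s"
  define G3 where "G3 = add_leaf G2 s t"
  define G4 where "G4 = subdiv G3 e v b"
  define G5 where "G5 = subdiv G4 e w c"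
  have m1: "tm3_mor G1 A (collapse v e)"
    unfolding G1_def by (rule subdiv_tm3_mor[OF A vw e])
  have "vorder G1 e \<le> 2"
    by (rule vorder_le[of _ _ "{v, w}"]) (use e in \<open>auto simp: G1_def card_insert_if dest: E\<close>)
  then have m2: "tm3_mor G2 G1 (collapse e s)"
    unfolding G2_def using s by (intro add_leaf_tm3_mor tm3_mor_obj[OF m1]) (auto simp: G1_def)
  have "vorder G2 s \<le> 2"
    by (rule vorder_le[of _ _ "{e}"]) (use s e vw in \<open>auto simp: G1_def G2_def dest: E\<close>)
  then have m3: "tm3_mor G3 G2 (collapse s t)"
    unfolding G3_def using t by (intro add_leaf_tm3_mor tm3_mor_obj[OF m2]) (auto simp: G1_def G2_def)
  have m4: "tm3_mor G4 G3 (collapse e b)"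
    unfolding G4_def using b e v by (intro subdiv_tm3_mor tm3_mor_obj[OF m3]) (auto simp: G1_def G2_def G3_def)
  have w: "w \<in> gV A" using E vw by blast
  have m5: "tm3_mor G5 G4 (collapse e c)"
    unfolding G5_def using c b e w vw v
    by (intro subdiv_tm3_mor tm3_mor_obj[OF m4]) (auto simp: G1_def G2_def G3_def G4_def)
  define g where "g = (\<lambda>x. collapse v e (collapse e s (collapse s t (collapse e b (collapse e c x)))))"
  have g: "tm3_mor G5 A g"
    unfolding g_def by (intro tm3_mor_comp[OF _ m1] tm3_mor_comp[OF _ m2] tm3_mor_comp[OF _ m3] tm3_mor_comp[OF _ m4] m5)
  have gr: "is_graph G5" using tm3_mor_tree(1)[OF m5] tree_is_graph by blast
  have V5: "gV G5 = insert c (insert b (insert t (insert s (insert e (gV A)))))"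
    by (simp add: G1_def G2_def G3_def G4_def G5_def)
  have in5: "(e, b) \<in> gE G5" "(b, v) \<in> gE G5" "(e, c) \<in> gE G5" "(c, w) \<in> gE G5" "(e, s) \<in> gE G5" "(s, t) \<in> gE G5"
    using vw v w e s t b c by (auto simp: G1_def G2_def G3_def G4_def G5_def)
  have out5: "(e, v) \<notin> gE G5" "(e, w) \<notin> gE G5" "(e, t) \<notin> gE G5"
    using vw v w e s t b c by (auto simp: G1_def G2_def G3_def G4_def G5_def dest: E)
  have con: "gconnected G5 {e, b, v}" "gconnected G5 {e, c, w}" "gconnected G5 {e, s, t}"
    using gconnected_two_edges[OF gr] in5 by blast+
  have dist: "e \<noteq> s" "e \<noteq> b" "e \<noteq> c" "e \<noteq> t" "v \<noteq> e" "w \<noteq> e" using e s t b c v w by auto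
  have ge: "g e = v" using dist by (simp add: g_def)
  have I: "{e, b, v} \<inter> {e, c, w} = {e}" "{e, b, v} \<inter> {e, s, t} = {e}" "{e, c, w} \<inter> {e, s, t} = {e}"
    using e s t b c v w vw by auto
  \<comment> \<open>The centre \<open>c\<close> of the statement is the vertex \<open>e\<close>
    here; the \<open>c\<close> of the proof is the middle of the second leg.\<close>
  show ?thesis
    by (rule exI[of _ G5], rule exI[of _ g], rule exI[of _ e], rule exI[of _ v], rule exI[of _ w], rule exI[of _ t],
        rule exI[of _ "{e, b, v}"], rule exI[of _ "{e, c, w}"], rule exI[of _ "{e, s, t}"])
      (use g ge I con out5 v w in \<open>simp add: V5\<close>)
qed

section \<open>Inverse limits\<close>

text \<open>Composite bonding map from level \<open>n + k\<close> to level \<open>n\<close>.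
  Indexing by the gap \<open>k\<close> avoids side conditions of the form
  \<open>n \<le> m\<close>.\<close>

fun bond :: "(nat \<Rightarrow> nat \<Rightarrow> nat) \<Rightarrow> nat \<Rightarrow> nat \<Rightarrow> nat \<Rightarrow> nat" where
  "bond \<alpha> n 0 u = u"
| "bond \<alpha> n (Suc k) u = bond \<alpha> n k (\<alpha> (n + k) u)"

text \<open>The recursion splits off the bonding map of the top level; this is the same composite
  seen from the bottom.\<close>

lemma bond_Suc: "\<alpha> m (bond \<alpha> (Suc m) k u) = bond \<alpha> m k (\<alpha> (m + k) u)"
  by (induction k arbitrary: u) simp_all

locale tm3_seq =
  fixes F :: "nat \<Rightarrow> fgraph" and \<alpha> :: "nat \<Rightarrow> nat \<Rightarrow> nat"
  assumes seq: "tm3_invseq F \<alpha>"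
begin

abbreviation "D \<equiv> limV F \<alpha>"
abbreviation "E \<equiv> limE F \<alpha>"
abbreviation "X \<equiv> limtop F \<alpha>"
abbreviation "Y \<equiv> realization F \<alpha>"

lemma mor: "tm3_mor (F (Suc n)) (F n) (\<alpha> n)"
  using seq by (simp add: tm3_invseq_def)

lemma obj: "tm3_obj (F n)"
  using tm3_mor_obj(2)[OF mor] .

lemma tree: "is_tree (F n)"
  using tm3_mor_tree(2)[OF mor] .

lemma graph: "is_graph (F n)"
  using tree_is_graph[OF tree] .

lemma fin: "finite (gV (F n))"
  using tree by (simp add: is_tree_def)

lemma edge_refl: "a \<in> gV (F n) \<Longrightarrow> (a, a) \<in> gE (F n)"
  using graph by (simp add: is_graph_def)

lemma edge_sym: "(a, b) \<in> gE (F n) \<Longrightarrow> (b, a) \<in> gE (F n)"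
  using graph[of n] by (simp add: is_graph_def)

lemma edge_in: "(a, b) \<in> gE (F n) \<Longrightarrow> a \<in> gV (F n) \<and> b \<in> gV (F n)"
  using graph[of n] by (auto simp: is_graph_def)

lemma limV_in: "z \<in> D \<Longrightarrow> z n \<in> gV (F n)"
  by (simp add: limV_def)

lemma limV_Suc: "z \<in> D \<Longrightarrow> \<alpha> n (z (Suc n)) = z n"
  by (simp add: limV_def)

lemma limE_iff: "(x, y) \<in> E \<longleftrightarrow> x \<in> D \<and> y \<in> D \<and> (\<forall>n. (x n, y n) \<in> gE (F n))"
  by (simp add: limE_def)

lemma limE_refl: "x \<in> D \<Longrightarrow> (x, x) \<in> E"
  by (simp add: limE_iff edge_refl limV_in)

lemma limE_sym: "(x, y) \<in> E \<Longrightarrow> (y, x) \<in> E"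
  by (simp add: limE_iff edge_sym)

lemma bond_mor: "tm3_mor (F (n + k)) (F n) (bond \<alpha> n k)"
proof (induction k)
  case 0
  have "bond \<alpha> n 0 = (\<lambda>x. x)" by auto
  then show ?case using tm3_mor_id[OF obj[of n]] by simp
next
  case (Suc k)
  have "bond \<alpha> n (Suc k) = (\<lambda>x. bond \<alpha> n k (\<alpha> (n + k) x))" by auto
  then show ?case using tm3_mor_comp[OF mor Suc] by simp
qed

lemma bond_proj: "z \<in> D \<Longrightarrow> bond \<alpha> n k (z (n + k)) = z n"
  by (induction k) (simp_all add: limV_Suc)

lemma bond_in: "u \<in> gV (F (n + k)) \<Longrightarrow> bond \<alpha> n k u \<in> gV (F n)"
  using tm3_mor_in[OF bond_mor] .

lemma eq_down:
  assumes "z \<in> D" "w \<in> D" "z m = w m" "n \<le> m"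
  shows "z n = w n"
  using bond_proj[OF assms(1), of n "m - n"] bond_proj[OF assms(2), of n "m - n"] assms(3,4) by simp

lemma edge_down:
  assumes "z \<in> D" "w \<in> D" "(z m, w m) \<in> gE (F m)" "n \<le> m"
  shows "(z n, w n) \<in> gE (F n)"
  using tm3_mor_edge[OF bond_mor[of n "m - n"], of "z m" "w m"] assms
    bond_proj[OF assms(1), of n "m - n"] bond_proj[OF assms(2), of n "m - n"] by simp

text \<open>The lift of an edge is chosen upwards from level \<open>n\<close>; the coordinate at level \<open>m\<close> is read off
  from the choice at level \<open>n + m\<close>, which avoids distinguishing \<open>m < n\<close>.\<close>

lemma lift_edge:
  assumes "(a, b) \<in> gE (F n)"
  obtains x y where "(x, y) \<in> E" "x n = a" "y n = b"
proof -
  let ?f = "\<lambda>m (a, b). (\<alpha> m a, \<alpha> m b)"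
  have "\<exists>s. \<forall>k. (s k \<in> gE (F (n + k)) \<and> (k = 0 \<longrightarrow> s k = (a, b))) \<and> ?f (n + k) (s (Suc k)) = s k"
  proof (rule dependent_nat_choice)
    fix t k assume "t \<in> gE (F (n + k)) \<and> (k = 0 \<longrightarrow> t = (a, b))"
    then have "t \<in> ?f (n + k) ` gE (F (Suc (n + k)))" using tm3_mor_edge_surj[OF mor[of "n + k"]] by simp
    then show "\<exists>t'. (t' \<in> gE (F (n + Suc k)) \<and> (Suc k = 0 \<longrightarrow> t' = (a, b))) \<and> ?f (n + k) t' = t"
      by auto
  qed (use assms in auto)
  then obtain s where s: "\<And>k. s k \<in> gE (F (n + k))" "s 0 = (a, b)" "\<And>k. ?f (n + k) (s (Suc k)) = s k"
    by blast
  define x where "x m = bond \<alpha> m n (fst (s m))" for m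
  define y where "y m = bond \<alpha> m n (snd (s m))" for m
  have f: "\<alpha> (n + k) (fst (s (Suc k))) = fst (s k)" "\<alpha> (n + k) (snd (s (Suc k))) = snd (s k)" for k
    using s(3)[of k] by (metis (no_types, lifting) case_prod_unfold fst_conv, metis (no_types, lifting) case_prod_unfold snd_conv)
  have e: "(x m, y m) \<in> gE (F m)" for m
    unfolding x_def y_def using s(1)[of m] by (intro tm3_mor_edge[OF bond_mor]) (simp add: add.commute)
  have "x \<in> D" "y \<in> D"
    using e edge_in f by (auto simp: limV_def x_def y_def bond_Suc add.commute)
  moreover have "bond \<alpha> n k (fst (s k)) = fst (s 0)" "bond \<alpha> n k (snd (s k)) = snd (s 0)" for k
    by (induction k) (simp_all add: f)
  ultimately show thesis using that[of x y] e s(2) by (simp add: limE_iff x_def y_def)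
qed

lemma lift_vertex:
  assumes "a \<in> gV (F n)"
  obtains x where "x \<in> D" "x n = a"
  using lift_edge[OF edge_refl[OF assms]] limE_iff by metis

section \<open>The vertex space of the limit: cylinders, compactness, threads\<close>

lemma topspace_X [simp]: "topspace X = D"
  by (simp add: limtop_def)

text \<open>Cylinders over a single level form a base: equality at level \<open>n\<close> entails
  equality at all lower levels, so finitely many conditions reduce to one.\<close>

lemma openin_X: "openin X U \<longleftrightarrow> U \<subseteq> D \<and> (\<forall>z\<in>U. \<exists>n. \<forall>w\<in>D. w n = z n \<longrightarrow> w \<in> U)"
proof
  assume "openin X U"
  then obtain T where T: "openin (product_topology (\<lambda>_. discrete_topology (UNIV :: nat set)) UNIV) T" "U = T \<inter> D"
    by (auto simp: limtop_def openin_subtopology)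
  have "\<exists>n. \<forall>w\<in>D. w n = z n \<longrightarrow> w \<in> U" if z: "z \<in> U" for z
  proof -
    obtain V where V: "finite {i. V i \<noteq> (UNIV :: nat set)}" "z \<in> Pi\<^sub>E UNIV V" "Pi\<^sub>E UNIV V \<subseteq> T"
      using T(1) z T(2) unfolding openin_product_topology_alt by fastforce
    obtain n where n: "{i. V i \<noteq> UNIV} \<subseteq> {..n}" using V(1) finite_nat_iff_bounded_le by blast
    have "w \<in> U" if "w \<in> D" "w n = z n" for w
    proof -
      have "w i \<in> V i" for i
      proof (cases "i \<le> n")
        case True
        then have "w i = z i" using eq_down[of w z n i] that z T(2) by blast
        then show ?thesis using V(2) by auto
      next
        case False
        then show ?thesis using n by auto
      qed
      then show ?thesis using V(3) T(2) that by auto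
    qed
    then show ?thesis by blast
  qed
  then show "U \<subseteq> D \<and> (\<forall>z\<in>U. \<exists>n. \<forall>w\<in>D. w n = z n \<longrightarrow> w \<in> U)" using T by blast
next
  assume U: "U \<subseteq> D \<and> (\<forall>z\<in>U. \<exists>n. \<forall>w\<in>D. w n = z n \<longrightarrow> w \<in> U)"
  have cyl: "openin X {w\<in>D. w n = a}" for n a
  proof -
    have "openin (product_topology (\<lambda>_. discrete_topology (UNIV :: nat set)) UNIV) {w. w n = a}"
      unfolding openin_product_topology_alt
    proof
      fix w :: "nat \<Rightarrow> nat" assume "w \<in> {w. w n = a}"
      then show "\<exists>U. finite {i \<in> UNIV. U i \<noteq> topspace (discrete_topology (UNIV :: nat set))} \<and>
          (\<forall>i\<in>UNIV. openin (discrete_topology UNIV) (U i)) \<and> w \<in> Pi\<^sub>E UNIV U \<and> Pi\<^sub>E UNIV U \<subseteq> {w. w n = a}"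
        by (intro exI[of _ "\<lambda>i. if i = n then {a} else UNIV"]) (auto simp: PiE_iff split: if_splits)
    qed
    then show ?thesis by (auto simp: limtop_def openin_subtopology)
  qed
  show "openin X U"
    unfolding openin_subopen[of X U]
  proof
    fix z assume "z \<in> U"
    then obtain n where "\<forall>w\<in>D. w n = z n \<longrightarrow> w \<in> U" using U by blast
    then show "\<exists>T. openin X T \<and> z \<in> T \<and> T \<subseteq> U"
      using cyl[of n "z n"] \<open>z \<in> U\<close> U by (intro exI[of _ "{w\<in>D. w n = z n}"]) auto
  qed
qed

lemma closedin_X: "closedin X C \<longleftrightarrow> C \<subseteq> D \<and> (\<forall>z\<in>D. (\<forall>n. \<exists>c\<in>C. c n = z n) \<longrightarrow> z \<in> C)"
proof -
  have "(\<forall>z\<in>D - C. \<exists>n. \<forall>w\<in>D. w n = z n \<longrightarrow> w \<in> D - C) \<longleftrightarrow>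
      (\<forall>z\<in>D. (\<forall>n. \<exists>c\<in>C. c n = z n) \<longrightarrow> z \<in> C)" if "C \<subseteq> D"
    using that by (meson Diff_iff subsetD)
  then show ?thesis unfolding closedin_def openin_X by auto
qed

lemma closedin_coords: "closedin X {z\<in>D. \<forall>n. P n (z n)}"
  unfolding closedin_X
proof (intro conjI ballI impI)
  fix z assume "z \<in> D" and z: "\<forall>n. \<exists>c\<in>{z\<in>D. \<forall>n. P n (z n)}. c n = z n"
  moreover have "P n (z n)" for n
  proof -
    from z obtain c where "\<forall>n. P n (c n)" "c n = z n" by blast
    then show ?thesis by metis
  qed
  ultimately show "z \<in> {z\<in>D. \<forall>n. P n (z n)}" by blast
qed blast

lemma closedin_cyl: "closedin X {z\<in>D. P (z n)}"
proof -
  have "{z\<in>D. \<forall>m. m = n \<longrightarrow> P (z m)} = {z\<in>D. P (z n)}" by auto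
  then show ?thesis using closedin_coords[of "\<lambda>m a. m = n \<longrightarrow> P a"] by simp
qed

lemma openin_cyl: "openin X {z\<in>D. P (z n)}"
  unfolding openin_X by (auto intro: exI[of _ n])

text \<open>Tychonoff for the finite level sets; the threads form a closed set because each of their
  equations involves two coordinates only.\<close>

lemma compact_X: "compact_space X"
proof -
  let ?P = "product_topology (\<lambda>_. discrete_topology (UNIV :: nat set)) UNIV"
  let ?K = "Pi\<^sub>E UNIV (\<lambda>n. gV (F n))"
  have "compactin ?P ?K"
    using fin by (simp add: compactin_PiE finite_imp_compactin)
  moreover have "closedin ?P D"
  proof -
    have "closedin ?P {x. x n \<in> gV (F n) \<and> \<alpha> n (x (Suc n)) = x n}" for n
    proof -
      have c: "continuous_map ?P (discrete_topology UNIV) (\<lambda>x. x i)" for i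
        by (rule continuous_map_product_projection) simp
      let ?Q = "\<lambda>a b. {x. x n = a} \<inter> {x. x (Suc n) = b}"
      have o: "openin ?P {x. x i = a}" for i a
        using openin_continuous_map_preimage[OF c[of i], of "{a}"] by (simp add: vimage_def)
      have "{x. \<not> (x n \<in> gV (F n) \<and> \<alpha> n (x (Suc n)) = x n)}
          = (\<Union>(a, b) \<in> {(a, b). \<not> (a \<in> gV (F n) \<and> \<alpha> n b = a)}. ?Q a b)" by auto
      moreover have "openin ?P \<dots>" using o by (intro openin_Union) (auto intro!: openin_Int)
      ultimately have "openin ?P {x. \<not> (x n \<in> gV (F n) \<and> \<alpha> n (x (Suc n)) = x n)}" by simp
      moreover have "UNIV - {x. x n \<in> gV (F n) \<and> \<alpha> n (x (Suc n)) = x n}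
        = {x. \<not> (x n \<in> gV (F n) \<and> \<alpha> n (x (Suc n)) = x n)}" by auto
      ultimately show ?thesis by (simp add: closedin_def)
    qed
    then have "closedin ?P (\<Inter>n. {x. x n \<in> gV (F n) \<and> \<alpha> n (x (Suc n)) = x n})" by (intro closedin_Inter) auto
    moreover have "(\<Inter>n. {x. x n \<in> gV (F n) \<and> \<alpha> n (x (Suc n)) = x n}) = D" by (auto simp: limV_def)
    ultimately show ?thesis by simp
  qed
  moreover have "D \<subseteq> ?K" by (auto simp: limV_def)
  ultimately have "compactin ?P D" using closed_compactin by blast
  then show ?thesis by (simp add: limtop_def compact_space_subtopology)
qed

lemma nest:
  assumes "\<And>n. closedin X (C n)" "\<And>n. C n \<noteq> {}" "\<And>n. C (Suc n) \<subseteq> C n"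
  shows "\<exists>z. \<forall>n. z \<in> C n"
proof -
  have "decseq C" by (rule decseq_SucI) (rule assms)
  with assms(1,2) have "(\<Inter>n. C n) \<noteq> {}" by (rule compact_space_imp_nest[OF compact_X])
  then show ?thesis by blast
qed

lemma Hausdorff_X: "Hausdorff_space X"
  unfolding Hausdorff_space_def
proof (intro allI impI)
  fix x y assume "x \<in> topspace X \<and> y \<in> topspace X \<and> x \<noteq> y"
  then obtain n where n: "x n \<noteq> y n" "x \<in> D" "y \<in> D" by (auto simp: fun_eq_iff)
  then show "\<exists>U V. openin X U \<and> openin X V \<and> x \<in> U \<and> y \<in> V \<and> disjnt U V"
    by (intro exI[of _ "{w\<in>D. w n = x n}"] exI[of _ "{w\<in>D. w n = y n}"]) (use openin_cyl in \<open>auto simp: disjnt_def\<close>)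
qed

lemma normal_X: "normal_space X"
  using compact_X Hausdorff_X compact_Hausdorff_or_regular_imp_normal_space by blast

text \<open>A form of Koenig's lemma. It produces the points of the limit that are specified level
  by level: successors in a segment, points with a prescribed parameter, medians.\<close>

lemma thread:
  assumes S: "\<And>n. S n \<subseteq> gV (F n)" "\<And>n. S n \<noteq> {}" "\<And>n u. u \<in> S (Suc n) \<Longrightarrow> \<alpha> n u \<in> S n"
  shows "\<exists>z\<in>D. \<forall>n. z n \<in> S n"
proof -
  have "\<exists>z. \<forall>n. z \<in> {z\<in>D. z n \<in> S n}"
  proof (rule nest)
    show "{z\<in>D. z n \<in> S n} \<noteq> {}" for n
    proof -
      obtain a where "a \<in> S n" using S(2) by blast
      moreover then have "a \<in> gV (F n)" using S(1) by blast
      ultimately show ?thesis by (metis (mono_tags, lifting) empty_iff lift_vertex mem_Collect_eq)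
    qed
    show "{z\<in>D. z (Suc n) \<in> S (Suc n)} \<subseteq> {z\<in>D. z n \<in> S n}" for n
      using S(3) limV_Suc by force
  qed (rule closedin_cyl)
  then show ?thesis by blast
qed

text \<open>Lets a projection play the role of \<open>f\<close> in the extension property.\<close>

lemma fomega_proj: "fomega_epi F \<alpha> (F n) (\<lambda>z. z n)"
  unfolding fomega_epi_def
proof (intro conjI)
  show "(\<lambda>z. z n) ` D = gV (F n)" using limV_in by (auto elim: lift_vertex intro: rev_image_eqI)
  have "gE (F n) \<subseteq> (\<lambda>(x, y). (x n, y n)) ` E"
  proof
    fix e assume "e \<in> gE (F n)"
    then obtain a b where "e = (a, b)" "(a, b) \<in> gE (F n)" by (cases e) auto
    then show "e \<in> (\<lambda>(x, y). (x n, y n)) ` E"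
      by (elim lift_edge[of a b n]) (auto intro!: rev_image_eqI)
  qed
  then show "(\<lambda>(x, y). (x n, y n)) ` E = gE (F n)" by (auto simp: limE_iff)
  show "\<exists>m h'. tm3_mor (F m) (F n) h' \<and> (\<forall>x\<in>D. x n = h' (x m))"
    using tm3_mor_id[OF obj] by blast
qed (auto simp: limE_iff limV_in)

end

section \<open>The realization\<close>

text \<open>The functions together embed the compact space into a countable power of the real
  line.\<close>

lemma metrizable_if_countably_separated:
  fixes f :: "'i::countable \<Rightarrow> 'a \<Rightarrow> real"
  assumes Z: "compact_space Z" "\<And>i. continuous_map Z euclideanreal (f i)"
    and sep: "\<And>x y. x \<in> topspace Z \<Longrightarrow> y \<in> topspace Z \<Longrightarrow> x \<noteq> y \<Longrightarrow> \<exists>i. f i x \<noteq> f i y"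
  shows "metrizable_space Z"
proof -
  let ?P = "product_topology (\<lambda>_. euclideanreal) (UNIV :: 'i set)"
  have "continuous_map Z ?P (\<lambda>x i. f i x)"
    using Z(2) by (simp add: continuous_map_componentwise_UNIV)
  moreover have "inj_on (\<lambda>x i. f i x) (topspace Z)"
    using sep by (auto simp: inj_on_def fun_eq_iff)
  moreover have "Hausdorff_space ?P" by (simp add: Hausdorff_space_product_topology)
  ultimately have "embedding_map Z ?P (\<lambda>x i. f i x)"
    using Z(1) by (intro continuous_imp_embedding_map)
  then have "Z homeomorphic_space subtopology ?P ((\<lambda>x i. f i x) ` topspace Z)"
    by (rule embedding_map_imp_homeomorphic_space)
  moreover have "metrizable_space ?P"
    by (simp add: metrizable_space_product_topology metrizable_space_euclidean)
  ultimately show ?thesis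
    using homeomorphic_metrizable_space metrizable_space_subtopology by blast
qed

locale tm3_trans = tm3_seq +
  assumes tr: "trans E"
begin

definition q :: "(nat \<Rightarrow> nat) \<Rightarrow> (nat \<Rightarrow> nat) set" where
  "q z = E `` {z}"

lemma limE_trans: "(x, y) \<in> E \<Longrightarrow> (y, z) \<in> E \<Longrightarrow> (x, z) \<in> E"
  using tr by (meson transD)

lemma q_eq: "z \<in> D \<Longrightarrow> w \<in> D \<Longrightarrow> q z = q w \<longleftrightarrow> (z, w) \<in> E"
  unfolding q_def using limE_refl limE_sym limE_trans by blast

lemma quotient_E: "D // E = q ` D"
  by (auto simp: quotient_def q_def)

lemma Union_q: "U \<subseteq> q ` D \<Longrightarrow> \<Union>U = {z\<in>D. q z \<in> U}"
proof -
  assume U: "U \<subseteq> q ` D"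
  have "z \<in> \<Union>U \<longleftrightarrow> z \<in> D \<and> q z \<in> U" for z
  proof
    assume "z \<in> \<Union>U"
    then obtain w where w: "w \<in> D" "q w \<in> U" "z \<in> q w" using U by blast
    then have "(w, z) \<in> E" by (simp add: q_def)
    moreover then have "z \<in> D" by (simp add: limE_iff)
    ultimately show "z \<in> D \<and> q z \<in> U" using w q_eq by metis
  next
    assume "z \<in> D \<and> q z \<in> U"
    then show "z \<in> \<Union>U" using limE_refl unfolding q_def by blast
  qed
  then show ?thesis by blast
qed

lemma openin_Y: "openin Y U \<longleftrightarrow> U \<subseteq> q ` D \<and> openin X {z\<in>D. q z \<in> U}"
proof -
  let ?O = "\<lambda>U. U \<subseteq> q ` D \<and> openin X {z\<in>D. q z \<in> U}"
  have "istopology ?O"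
    unfolding istopology_def
  proof (intro conjI allI impI)
    fix S T assume S: "?O S" and T: "?O T"
    then show "S \<inter> T \<subseteq> q ` D" by blast
    have "{z\<in>D. q z \<in> S \<inter> T} = {z\<in>D. q z \<in> S} \<inter> {z\<in>D. q z \<in> T}" by blast
    then show "openin X {z\<in>D. q z \<in> S \<inter> T}"
      using openin_Int[OF conjunct2[OF S] conjunct2[OF T]] by (simp only:)
  next
    fix K assume K: "\<forall>S\<in>K. ?O S"
    then show "\<Union>K \<subseteq> q ` D" by blast
    have "{z\<in>D. q z \<in> \<Union>K} = (\<Union>S\<in>K. {z\<in>D. q z \<in> S})" by blast
    then show "openin X {z\<in>D. q z \<in> \<Union>K}" using K by auto
  qed
  moreover have "(\<lambda>U. U \<subseteq> topspace X // E \<and> openin X (\<Union>U)) = ?O"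
    by (intro ext) (auto simp: quotient_E Union_q)
  ultimately show ?thesis by (simp add: realization_def quotient_top_def)
qed

lemma topspace_Y: "topspace Y = q ` D"
proof
  show "topspace Y \<subseteq> q ` D" using openin_Y openin_topspace by blast
  have "{z\<in>D. q z \<in> q ` D} = topspace X" by auto
  then have "openin Y (q ` D)" unfolding openin_Y by (metis openin_topspace order_refl)
  then show "q ` D \<subseteq> topspace Y" by (rule openin_subset)
qed

lemma closedin_Y: "closedin Y A \<longleftrightarrow> A \<subseteq> q ` D \<and> closedin X {z\<in>D. q z \<in> A}"
proof -
  have "{z\<in>D. q z \<in> q ` D - A} = D - {z\<in>D. q z \<in> A}" by auto
  then show ?thesis by (auto simp: closedin_def openin_Y topspace_Y)
qed

lemma closedin_point: "z \<in> D \<Longrightarrow> closedin X {z}"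
  using Hausdorff_X closedin_Hausdorff_sing_eq by fastforce

text \<open>Compactness, used twice: if every level had an edge between the two sets, nested closed
  sets would first yield a point \<open>x\<close> of \<open>P\<close> that has an edge into
  \<open>Q\<close> at every level, and then a single \<open>y\<close> in \<open>Q\<close> adjacent
  to \<open>x\<close>. This is how the limit is controlled from finite levels.\<close>

lemma separate:
  assumes P: "closedin X P" and Q: "closedin X Q" and PQ: "\<And>x y. x \<in> P \<Longrightarrow> y \<in> Q \<Longrightarrow> (x, y) \<notin> E"
  shows "\<exists>n. \<forall>x\<in>P. \<forall>y\<in>Q. (x n, y n) \<notin> gE (F n)"
proof -
  have sub: "P \<subseteq> D" "Q \<subseteq> D" using P Q closedin_subset by fastforce+
  show ?thesis
  proof (rule ccontr)
    assume *: "\<not> ?thesis"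
    have "\<exists>x. \<forall>n. x \<in> P \<inter> {x\<in>D. \<exists>y\<in>Q. (x n, y n) \<in> gE (F n)}"
    proof (rule nest)
      show "closedin X (P \<inter> {x\<in>D. \<exists>y\<in>Q. (x n, y n) \<in> gE (F n)})" for n
        using P closedin_cyl[of "\<lambda>a. \<exists>y\<in>Q. (a, y n) \<in> gE (F n)" n] by (rule closedin_Int)
      show "P \<inter> {x\<in>D. \<exists>y\<in>Q. (x n, y n) \<in> gE (F n)} \<noteq> {}" for n using * sub by blast
      show "P \<inter> {x\<in>D. \<exists>y\<in>Q. (x (Suc n), y (Suc n)) \<in> gE (F (Suc n))}
          \<subseteq> P \<inter> {x\<in>D. \<exists>y\<in>Q. (x n, y n) \<in> gE (F n)}" for n
      proof
        fix x assume "x \<in> P \<inter> {x\<in>D. \<exists>y\<in>Q. (x (Suc n), y (Suc n)) \<in> gE (F (Suc n))}"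
        then obtain y where "x \<in> P" "x \<in> D" "y \<in> Q" "(x (Suc n), y (Suc n)) \<in> gE (F (Suc n))" by blast
        moreover then have "(x n, y n) \<in> gE (F n)" using edge_down[of x y "Suc n" n] sub by auto
        ultimately show "x \<in> P \<inter> {x\<in>D. \<exists>y\<in>Q. (x n, y n) \<in> gE (F n)}" by blast
      qed
    qed
    then obtain x where x: "x \<in> P" "\<And>n. \<exists>y\<in>Q. (x n, y n) \<in> gE (F n)" by blast
    have "\<exists>y. \<forall>n. y \<in> Q \<inter> {y\<in>D. (x n, y n) \<in> gE (F n)}"
    proof (rule nest)
      show "closedin X (Q \<inter> {y\<in>D. (x n, y n) \<in> gE (F n)})" for n
        using Q closedin_cyl[of "\<lambda>a. (x n, a) \<in> gE (F n)" n] by (rule closedin_Int)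
      show "Q \<inter> {y\<in>D. (x n, y n) \<in> gE (F n)} \<noteq> {}" for n using x(2)[of n] sub by blast
      show "Q \<inter> {y\<in>D. (x (Suc n), y (Suc n)) \<in> gE (F (Suc n))} \<subseteq> Q \<inter> {y\<in>D. (x n, y n) \<in> gE (F n)}" for n
        using edge_down[of x _ "Suc n" n] x(1) sub by auto
    qed
    then obtain y where "y \<in> Q" "\<And>n. (x n, y n) \<in> gE (F n)" by blast
    then show False using PQ[OF x(1), of y] x(1) sub by (auto simp: limE_iff)
  qed
qed

lemma continuous_q: "continuous_map X Y q"
  unfolding continuous_map_def by (auto simp: topspace_Y openin_Y)

text \<open>Applying \<open>separate\<close> to \<open>C\<close> and a point not adjacent to it
  shows that the saturation of \<open>C\<close> is closed. Being closed, \<open>q\<close> hands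
  normality and the Hausdorff property down to the quotient.\<close>

lemma closed_q: "closed_map X Y q"
  unfolding closed_map_def
proof (intro allI impI)
  fix C assume C: "closedin X C"
  then have CD: "C \<subseteq> D" using closedin_subset by fastforce
  have "closedin X {z\<in>D. q z \<in> q ` C}"
    unfolding closedin_X
  proof (intro conjI ballI impI)
    fix z assume z: "z \<in> D" "\<forall>n. \<exists>c\<in>{z\<in>D. q z \<in> q ` C}. c n = z n"
    show "z \<in> {z\<in>D. q z \<in> q ` C}"
    proof (rule ccontr)
      assume "z \<notin> {z\<in>D. q z \<in> q ` C}"
      then have "(z, c) \<notin> E" if "c \<in> C" for c
        using that z(1) CD q_eq[of z c] by auto
      then obtain n where n: "\<And>c. c \<in> C \<Longrightarrow> (z n, c n) \<notin> gE (F n)"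
        using separate[OF closedin_point[OF z(1)] C] by blast
      obtain w c where "w \<in> D" "w n = z n" "c \<in> C" "q w = q c" using z(2) by blast
      moreover from this have "c \<in> D" using CD by blast
      ultimately show False using n[of c] q_eq[of w c] limE_iff by metis
    qed
  qed blast
  then show "closedin Y (q ` C)" using CD by (auto simp: closedin_Y)
qed

lemma compact_Y: "compact_space Y"
  using image_compactin[OF compact_X[unfolded compact_space_def] continuous_q]
  by (simp add: compact_space_def topspace_Y)

lemma Hausdorff_Y: "Hausdorff_space Y" and normal_Y: "normal_space Y"
  using normal_Hausdorff_space_closed_continuous_map_image[OF normal_X Hausdorff_X closed_q continuous_q]
  by (simp_all add: topspace_Y)

text \<open>One Urysohn function is taken for each level and each pair of vertices whose cylinders
  have disjoint images. These countably many functions separate points, because cylinders over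
  non-adjacent vertices have disjoint images.\<close>

lemma metrizable_Y: "metrizable_space Y"
proof -
  let ?M = "\<lambda>n a. q ` {z\<in>D. z n = a}"
  have cM: "closedin Y (?M n a)" for n a
    using closed_q closedin_cyl[of "\<lambda>x. x = a" n] unfolding closed_map_def by blast
  define R where "R i f \<longleftrightarrow> continuous_map Y euclideanreal f \<and> (\<forall>n a b. i = (n, a, b) \<longrightarrow>
      disjnt (?M n a) (?M n b) \<longrightarrow> f ` ?M n a \<subseteq> {0} \<and> f ` ?M n b \<subseteq> {1})"
    for i :: "nat \<times> nat \<times> nat" and f
  have "\<exists>f. R i f" for i
  proof -
    obtain n a b where i: "i = (n, a, b)" by (cases i)
    show ?thesis
    proof (cases "disjnt (?M n a) (?M n b)")
      case True
      obtain f where "continuous_map Y euclideanreal f" "f ` ?M n a \<subseteq> {0}" "f ` ?M n b \<subseteq> {1}"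
        by (rule Urysohn_lemma_alt[OF normal_Y cM cM True])
      then have "R i f" by (simp add: R_def i)
      then show ?thesis by blast
    next
      case False
      \<comment> \<open>For the remaining triples the requirement is void, and the constant 0 is a
        mere default.\<close>
      then have "R i (\<lambda>_. 0)" by (simp add: R_def i)
      then show ?thesis by blast
    qed
  qed
  then have "\<forall>i. \<exists>f. R i f" by blast
  from choice[OF this] obtain g where g: "\<And>i. R i (g i)" by blast
  show ?thesis
  proof (rule metrizable_if_countably_separated[of Y g])
    show "continuous_map Y euclideanreal (g i)" for i using g[of i] by (simp add: R_def)
    fix x y assume "x \<in> topspace Y" "y \<in> topspace Y" "x \<noteq> y"
    then obtain z w where zw: "z \<in> D" "w \<in> D" "x = q z" "y = q w" "q z \<noteq> q w"
      unfolding topspace_Y by blast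
    then have "(z, w) \<notin> E" using q_eq by blast
    with zw obtain n where n: "(z n, w n) \<notin> gE (F n)" by (auto simp: limE_iff)
    have "disjnt (?M n (z n)) (?M n (w n))"
    proof (rule ccontr)
      assume "\<not> ?thesis"
      then obtain z' w' where "z' \<in> D" "w' \<in> D" "z' n = z n" "w' n = w n" "q z' = q w'"
        by (auto simp: disjnt_def)
      then show False using n q_eq[of z' w'] limE_iff by metis
    qed
    then have "g (n, z n, w n) ` ?M n (z n) \<subseteq> {0}" "g (n, z n, w n) ` ?M n (w n) \<subseteq> {1}"
      using g[of "(n, z n, w n)"] by (simp_all add: R_def)
    then have "g (n, z n, w n) x = 0" "g (n, z n, w n) y = 1" using zw by blast+
    then show "\<exists>i. g i x \<noteq> g i y" by (intro exI[of _ "(n, z n, w n)"]) simp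
  qed (rule compact_Y)
qed

text \<open>A separation of the image pulls back to two closed sets without an edge between them,
  and \<open>separate\<close> makes this visible at some level. As vertices carry loops, the
  projections to that level are even disjoint, against connectedness there.\<close>

lemma connected_if_levels:
  assumes C: "closedin X C" and lev: "\<And>n. gconnected (F n) ((\<lambda>z. z n) ` C)"
  shows "connectedin Y (q ` C)"
  unfolding connectedin_closedin
proof (intro conjI notI)
  have CD: "C \<subseteq> D" using C closedin_subset by fastforce
  then show "q ` C \<subseteq> topspace Y" by (auto simp: topspace_Y)
  assume "\<exists>E1 E2. closedin Y E1 \<and> closedin Y E2 \<and> q ` C \<subseteq> E1 \<union> E2 \<and> E1 \<inter> E2 \<inter> q ` C = {}
    \<and> E1 \<inter> q ` C \<noteq> {} \<and> E2 \<inter> q ` C \<noteq> {}"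
  then obtain A B where AB: "closedin Y A" "closedin Y B" "q ` C \<subseteq> A \<union> B" "A \<inter> B \<inter> q ` C = {}"
    "A \<inter> q ` C \<noteq> {}" "B \<inter> q ` C \<noteq> {}" by (elim exE conjE)
  define P where "P = C \<inter> {z\<in>D. q z \<in> A}"
  define Q where "Q = C \<inter> {z\<in>D. q z \<in> B}"
  have cP: "closedin X P" "closedin X Q" using AB C by (auto simp: P_def Q_def closedin_Y)
  have "(x, y) \<notin> E" if "x \<in> P" "y \<in> Q" for x y
    using that AB(4) q_eq[of x y] by (auto simp: P_def Q_def)
  then obtain n where n: "\<And>x y. x \<in> P \<Longrightarrow> y \<in> Q \<Longrightarrow> (x n, y n) \<notin> gE (F n)"
    using separate[OF cP] by blast
  have un: "C \<subseteq> P \<union> Q" using AB(3) CD by (auto simp: P_def Q_def)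
  obtain a b where "a \<in> P" "b \<in> Q" using AB(5,6) CD by (auto simp: P_def Q_def)
  moreover then have "b n \<notin> (\<lambda>z. z n) ` P"
  proof -
    have "b n \<noteq> x n" if "x \<in> P" for x
      using n[OF that \<open>b \<in> Q\<close>] edge_refl[of "b n" n] limV_in[of b n] \<open>b \<in> Q\<close> by (auto simp: Q_def)
    then show ?thesis by blast
  qed
  ultimately obtain u v where uv: "u \<in> (\<lambda>z. z n) ` C" "u \<in> (\<lambda>z. z n) ` P" "v \<in> (\<lambda>z. z n) ` C"
    "v \<notin> (\<lambda>z. z n) ` P" "(u, v) \<in> gE (F n)"
    by (elim gconnected_cross[OF lev[of n], of "a n" "(\<lambda>z. z n) ` P" "b n", rotated -1]) (auto simp: P_def Q_def)
  then obtain x y where "u = x n" "x \<in> P" "v = y n" "y \<in> C" "y \<notin> P" by blast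
  then show False using n[of x y] un uv(5) by blast
qed

text \<open>A separation at level \<open>n\<close> splits the saturated preimage of \<open>A\<close>
  into two closed parts without an edge between them. Their images under the closed map
  \<open>q\<close> are closed and disjoint, so one of them is empty.\<close>

lemma levels_if_connected:
  assumes A: "closedin Y A" "connectedin Y A"
  shows "gconnected (F n) ((\<lambda>z. z n) ` {z\<in>D. q z \<in> A})"
proof (rule gconnectedI)
  let ?C = "{z\<in>D. q z \<in> A}"
  fix P assume P: "P \<subseteq> (\<lambda>z. z n) ` ?C" "P \<noteq> {}"
    "\<And>x y. x \<in> P \<Longrightarrow> y \<in> (\<lambda>z. z n) ` ?C - P \<Longrightarrow> (x, y) \<notin> gE (F n)"
  have C: "closedin X ?C" using A(1) by (simp add: closedin_Y)
  have im: "closedin Y (q ` (?C \<inter> {z\<in>D. R (z n)}))" for R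
    using closed_q C closedin_cyl[of R n] unfolding closed_map_def by blast
  let ?A1 = "q ` (?C \<inter> {z\<in>D. z n \<in> P})" and ?A2 = "q ` (?C \<inter> {z\<in>D. z n \<notin> P})"
  have "A \<subseteq> q ` D" using A(1) by (simp add: closedin_Y)
  then have cov: "A \<subseteq> ?A1 \<union> ?A2" by auto
  have dis: "?A1 \<inter> ?A2 \<inter> A = {}"
  proof (rule ccontr)
    assume "?A1 \<inter> ?A2 \<inter> A \<noteq> {}"
    then obtain z w where "z \<in> ?C" "z n \<in> P" "w \<in> ?C" "w n \<notin> P" "q z = q w" by auto
    then show False using P(3)[of "z n" "w n"] q_eq[of z w] by (auto simp: limE_iff)
  qed
  have ne: "?A1 \<inter> A \<noteq> {}" using P(1,2) by auto
  have "?A2 \<inter> A = {}"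
  proof (rule ccontr)
    assume ne2: "?A2 \<inter> A \<noteq> {}"
    have "\<exists>E1 E2. closedin Y E1 \<and> closedin Y E2 \<and> A \<subseteq> E1 \<union> E2 \<and> E1 \<inter> E2 \<inter> A = {}
        \<and> E1 \<inter> A \<noteq> {} \<and> E2 \<inter> A \<noteq> {}"
      by (rule exI[of _ ?A1], rule exI[of _ ?A2]) (intro conjI im cov dis ne ne2)
    then show False using A(2) unfolding connectedin_closedin by (elim conjE notE)
  qed
  then show "P = (\<lambda>z. z n) ` ?C" using P(1) by blast
qed

text \<open>Above level \<open>n\<close> the projections are preimages of \<open>S\<close>,
  connected by monotonicity; below, they are images of \<open>S\<close>, connected because bonding
  maps preserve edges.\<close>

lemma cylinder_connected:
  assumes S: "S \<subseteq> gV (F n)" "gconnected (F n) S"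
  shows "connectedin Y (q ` {z\<in>D. z n \<in> S})"
proof (rule connected_if_levels[OF closedin_cyl])
  fix m
  consider k where "m = n + k" | k where "n = m + k" by (metis le_add_diff_inverse nat_le_linear)
  then show "gconnected (F m) ((\<lambda>z. z m) ` {z\<in>D. z n \<in> S})"
  proof cases
    case (1 k)
    have "(\<lambda>z. z m) ` {z\<in>D. z n \<in> S} = {u\<in>gV (F (n + k)). bond \<alpha> n k u \<in> S}" (is "?L = ?R")
    proof
      show "?L \<subseteq> ?R" using 1 limV_in bond_proj by auto
      show "?R \<subseteq> ?L"
      proof
        fix u assume u: "u \<in> ?R"
        then obtain z where "z \<in> D" "z (n + k) = u" using lift_vertex by blast
        then show "u \<in> ?L" using u bond_proj[of z n k] 1 by auto
      qed
    qed
    then show ?thesis using tm3_mor_preimage[OF bond_mor S] 1 by simp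
  next
    case (2 k)
    have "(\<lambda>z. z m) ` {z\<in>D. z n \<in> S} = bond \<alpha> m k ` S" (is "?L = ?R")
    proof
      show "?L \<subseteq> ?R" using 2 bond_proj[of _ m k] by (auto intro: rev_image_eqI)
      show "?R \<subseteq> ?L"
      proof
        fix u assume "u \<in> ?R"
        then obtain s where s: "s \<in> S" "u = bond \<alpha> m k s" by blast
        then obtain z where "z \<in> D" "z n = s" using lift_vertex[of s n] S(1) by blast
        then show "u \<in> ?L" using s bond_proj[of z m k] 2 by auto
      qed
    qed
    then show ?thesis using tm3_mor_image_connected[OF bond_mor, of m k S] S 2 by simp
  qed
qed

lemma connected_Y: "connected_space Y"
proof -
  have "{z\<in>D. z 0 \<in> gV (F 0)} = D" using limV_in by blast
  then show ?thesis
    using cylinder_connected[OF order_refl tree_connected[OF tree], of 0]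
    by (simp add: topspace_Y connectedin_topspace flip: connectedin_topspace)
qed

lemma nonempty_Y: "topspace Y \<noteq> {}"
proof -
  have "gV (F 0) \<noteq> {}" using obj[of 0] by (auto simp: tm3_obj_def)
  then obtain z where "z \<in> D" using lift_vertex by blast
  then show ?thesis unfolding topspace_Y by blast
qed

lemma continuum_Y: "continuum Y"
  unfolding continuum_def by (intro conjI nonempty_Y compact_Y connected_Y metrizable_Y)

section \<open>Local connectedness and hereditary unicoherence\<close>

lemma star_subset:
  assumes V: "openin Y V" and z: "z \<in> D" "q z \<in> V"
  obtains n where "\<And>w. w \<in> D \<Longrightarrow> (z n, w n) \<in> gE (F n) \<Longrightarrow> q w \<in> V"
proof -
  have "openin X {w\<in>D. q w \<in> V}" using V by (simp add: openin_Y)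
  then have "closedin X (D - {w\<in>D. q w \<in> V})" using closedin_diff[OF closedin_topspace[of X]] by simp
  moreover have "(x, w) \<notin> E" if "x \<in> {z}" "w \<in> D - {w\<in>D. q w \<in> V}" for x w
    using that z q_eq[of z w] by auto
  \<comment> \<open>Points adjacent to \<open>z\<close> have the same class, which lies in
    \<open>V\<close>; so \<open>z\<close> has no edge into the closed complement, and
    \<open>separate\<close> yields the level.\<close>
  ultimately obtain n where n: "\<forall>x\<in>{z}. \<forall>w\<in>D - {w\<in>D. q w \<in> V}. (x n, w n) \<notin> gE (F n)"
    using separate[OF closedin_point[OF z(1)], of "D - {w\<in>D. q w \<in> V}"] by blast
  show thesis by (rule that[of n]) (use n in blast)
qed

lemma locally_connected_Y: "locally_connected_space Y"
  unfolding locally_connected_space_im_kleinen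
proof (intro allI impI)
  fix V x assume "openin Y V \<and> x \<in> V"
  then have V: "openin Y V" "x \<in> V" by auto
  then obtain z where z: "z \<in> D" "x = q z" using openin_subset topspace_Y by blast
  obtain n where n: "\<And>w. w \<in> D \<Longrightarrow> (z n, w n) \<in> gE (F n) \<Longrightarrow> q w \<in> V"
    using star_subset V z by metis
  let ?S = "{a\<in>gV (F n). (z n, a) \<in> gE (F n)}"
  have "gconnected (F n) ?S"
  proof (rule gconnected_star[of "z n"])
    show "z n \<in> ?S" using z limV_in edge_refl by auto
    fix b assume "b \<in> ?S"
    then show "\<exists>T\<subseteq>?S. z n \<in> T \<and> b \<in> T \<and> gconnected (F n) T"
      using gconnected_edge[OF graph, of "z n" b] limV_in[OF z(1)] edge_refl
      by (intro exI[of _ "{z n, b}"]) auto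
  qed
  then have con: "connectedin Y (q ` {w\<in>D. w n \<in> ?S})" by (intro cylinder_connected) auto
  \<comment> \<open>The image of the star is connected but need not be open. The classes lying
    entirely inside the star do form an open set, and the image of the star joins each of them to
    \<open>x\<close>.\<close>
  let ?U = "topspace Y - q ` {w\<in>D. (z n, w n) \<notin> gE (F n)}"
  show "\<exists>U. openin Y U \<and> x \<in> U \<and> U \<subseteq> V \<and> (\<forall>y\<in>U. \<exists>C. connectedin Y C \<and> C \<subseteq> V \<and> x \<in> C \<and> y \<in> C)"
  proof (rule exI[of _ ?U], intro conjI ballI)
    show "openin Y ?U"
      using closed_q closedin_cyl[of "\<lambda>a. (z n, a) \<notin> gE (F n)" n] by (simp add: closed_map_def openin_diff)
    show "x \<in> ?U" using z q_eq by (auto simp: topspace_Y limE_iff)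
    show "?U \<subseteq> V" using n by (auto simp: topspace_Y)
    fix y assume "y \<in> ?U"
    then obtain w where "w \<in> D" "y = q w" "(z n, w n) \<in> gE (F n)" by (auto simp: topspace_Y)
    then show "\<exists>C. connectedin Y C \<and> C \<subseteq> V \<and> x \<in> C \<and> y \<in> C"
      using con n z limV_in edge_refl by (intro exI[of _ "q ` {w\<in>D. w n \<in> ?S}"]) auto
  qed
qed

text \<open>The threads through the sets \<open>S m\<close> may miss vertices of \<open>S n\<close>.
  By compactness a missed vertex already drops out of the image of some \<open>S (n + k)\<close>; as
  the level is finite, one gap serves all missed vertices, and the projection is the connected image
  of a single set.\<close>

lemma limit_levels_connected:
  assumes S: "\<And>n. S n \<subseteq> gV (F n)" "\<And>n. gconnected (F n) (S n)"
    and down: "\<And>n u. u \<in> S (Suc n) \<Longrightarrow> \<alpha> n u \<in> S n"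
  shows "gconnected (F n) ((\<lambda>z. z n) ` {z\<in>D. \<forall>m. z m \<in> S m})"
proof -
  let ?T = "(\<lambda>z. z n) ` {z\<in>D. \<forall>m. z m \<in> S m}"
  have dec: "bond \<alpha> n (k + j) ` S (n + (k + j)) \<subseteq> bond \<alpha> n k ` S (n + k)" for k j
    by (induction j) (auto simp: down dest!: subsetD)
  have miss: "\<exists>k. v \<notin> bond \<alpha> n k ` S (n + k)" if v: "v \<notin> ?T" for v
  proof (rule ccontr)
    assume *: "\<not> ?thesis"
    have "\<exists>z. \<forall>k. z \<in> {z\<in>D. z (n + k) \<in> S (n + k)} \<inter> {z\<in>D. z n = v}"
    proof (rule nest)
      show "{z\<in>D. z (n + k) \<in> S (n + k)} \<inter> {z\<in>D. z n = v} \<noteq> {}" for k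
      proof -
        obtain u where "u \<in> S (n + k)" "v = bond \<alpha> n k u" using * by blast
        moreover then obtain z where "z \<in> D" "z (n + k) = u" using lift_vertex S(1) by blast
        ultimately show ?thesis using bond_proj[of z n k] by auto
      qed
      show "{z\<in>D. z (n + Suc k) \<in> S (n + Suc k)} \<inter> {z\<in>D. z n = v}
          \<subseteq> {z\<in>D. z (n + k) \<in> S (n + k)} \<inter> {z\<in>D. z n = v}" for k
      proof
        fix z assume "z \<in> {z\<in>D. z (n + Suc k) \<in> S (n + Suc k)} \<inter> {z\<in>D. z n = v}"
        then have "z \<in> D" "z n = v" "z (Suc (n + k)) \<in> S (Suc (n + k))" by auto
        then show "z \<in> {z\<in>D. z (n + k) \<in> S (n + k)} \<inter> {z\<in>D. z n = v}"
          using down[of "z (Suc (n + k))" "n + k"] limV_Suc[of z "n + k"] by auto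
      qed
    qed (intro closedin_Int closedin_cyl)
    then obtain z where z: "z \<in> D" "z n = v" "\<And>k. z (n + k) \<in> S (n + k)" by blast
    \<comment> \<open>So far \<open>z\<close> is known to meet the sets from level \<open>n\<close>
      on; the bonding maps carry this down to the lower levels.\<close>
    have low: "z (m - j) \<in> S (m - j)" if "z m \<in> S m" for m j
    proof (induction j)
      case (Suc j)
      show ?case
      proof (cases "m - j")
        case (Suc i)
        then have "m - Suc j = i" by simp
        then show ?thesis using Suc.IH down[of "z (Suc i)" i] limV_Suc[OF z(1), of i] Suc by simp
      qed (use Suc in simp)
    qed (use that in simp)
    have "z m \<in> S m" for m using low[of "n + m" n] z(3)[of m] by simp
    then show False using v z(1,2) by blast
  qed
  then have "\<forall>v. \<exists>k. v \<notin> ?T \<longrightarrow> v \<notin> bond \<alpha> n k ` S (n + k)" by blast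
  from choice[OF this] obtain k where k: "\<And>v. v \<notin> ?T \<Longrightarrow> v \<notin> bond \<alpha> n (k v) ` S (n + k v)" by blast
  \<comment> \<open>The value 0 covers the case that no vertex drops out.\<close>
  let ?K = "Max (insert 0 (k ` (gV (F n) - ?T)))"
  have "bond \<alpha> n ?K ` S (n + ?K) = ?T" (is "?L = _")
  proof
    show "?T \<subseteq> ?L" using bond_proj[of _ n ?K] by (auto intro!: rev_image_eqI)
    show "?L \<subseteq> ?T"
    proof
      fix v assume v: "v \<in> ?L"
      show "v \<in> ?T"
      proof (rule ccontr)
        assume nv: "v \<notin> ?T"
        have "v \<in> gV (F n)" using v S(1) bond_in by blast
        then have "k v \<le> ?K" using nv fin[of n] by (intro Max_ge) auto
        then have "bond \<alpha> n ?K ` S (n + ?K) \<subseteq> bond \<alpha> n (k v) ` S (n + k v)"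
          using dec[of "k v" "?K - k v"] by simp
        then have "v \<in> bond \<alpha> n (k v) ` S (n + k v)" using v by blast
        then show False using k[OF nv] by blast
      qed
    qed
  qed
  moreover have "gconnected (F n) (bond \<alpha> n ?K ` S (n + ?K))"
    by (rule tm3_mor_image_connected[OF bond_mor S(2)])
  ultimately show ?thesis by (simp only:)
qed

text \<open>The projection of an intersection may be smaller than the intersection of the
  projections; \<open>limit_levels_connected\<close> bridges this gap. The threads running through
  both families of projections are exactly the points of both preimages, since a closed set is
  recovered from its projections.\<close>

lemma hereditarily_unicoherent_Y: "hereditarily_unicoherent Y"
  unfolding hereditarily_unicoherent_def
proof (intro allI impI)
  fix A B assume *: "closedin Y A \<and> connectedin Y A \<and> A \<noteq> {} \<and> closedin Y B \<and> connectedin Y B \<and> B \<noteq> {}"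
  let ?p = "\<lambda>A n. (\<lambda>z. z n) ` {z\<in>D. q z \<in> A}"
  have con: "gconnected (F n) (?p A n)" "gconnected (F n) (?p B n)" for n
    using levels_if_connected * by blast+
  have sub: "?p K n \<subseteq> gV (F n)" for K n using limV_in by blast
  have down: "\<alpha> n u \<in> ?p K n" if "u \<in> ?p K (Suc n)" for K n u
    using that limV_Suc by (auto intro!: rev_image_eqI)
  let ?C = "{z\<in>D. \<forall>n. z n \<in> ?p A n \<inter> ?p B n}"
  have "gconnected (F n) ((\<lambda>z. z n) ` ?C)" for n
    using con sub down by (intro limit_levels_connected gconnected_Int[OF tree]) blast+
  then have "connectedin Y (q ` ?C)" by (intro connected_if_levels closedin_coords)
  moreover have "?C = {z\<in>D. q z \<in> A} \<inter> {z\<in>D. q z \<in> B}" (is "_ = ?R")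
  proof
    show "?R \<subseteq> ?C" by blast
    have in_closed: "z \<in> {z\<in>D. q z \<in> K}" if "closedin Y K" "z \<in> D" "\<And>n. z n \<in> ?p K n" for K z
    proof -
      have "closedin X {z\<in>D. q z \<in> K}" using that(1) by (simp add: closedin_Y)
      moreover have "\<exists>c\<in>{z\<in>D. q z \<in> K}. c n = z n" for n using that(3)[of n] by auto
      ultimately show ?thesis using that(2) unfolding closedin_X by blast
    qed
    show "?C \<subseteq> ?R"
    proof
      fix z assume "z \<in> ?C"
      then have "z \<in> D" "\<And>n. z n \<in> ?p A n" "\<And>n. z n \<in> ?p B n" by auto
      then show "z \<in> ?R" using in_closed[of A z] in_closed[of B z] * by blast
    qed
  qed
  moreover have "q ` ?R = A \<inter> B" using * by (auto simp: closedin_Y)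
  ultimately show "connectedin Y (A \<inter> B)" by simp
qed

end

section \<open>Segments and arcs\<close>

context tm3_seq
begin

definition seg :: "(nat \<Rightarrow> nat) \<Rightarrow> (nat \<Rightarrow> nat) \<Rightarrow> (nat \<Rightarrow> nat) set" where
  "seg x y = {z\<in>D. \<forall>n. z n \<in> iv (F n) (x n) (y n)}"

lemma segI: "z \<in> D \<Longrightarrow> (\<And>n. z n \<in> iv (F n) (x n) (y n)) \<Longrightarrow> z \<in> seg x y"
  by (simp add: seg_def)

lemma segD: "z \<in> seg x y \<Longrightarrow> z \<in> D" "z \<in> seg x y \<Longrightarrow> z n \<in> iv (F n) (x n) (y n)"
  by (simp_all add: seg_def)

lemma seg_commute:
  assumes "x \<in> D" "y \<in> D"
  shows "seg x y = seg y x"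
proof -
  have "iv (F n) (x n) (y n) = iv (F n) (y n) (x n)" for n
    using assms by (intro iv_commute[OF tree] limV_in)
  then show ?thesis by (simp add: seg_def)
qed

lemma seg_left: "x \<in> D \<Longrightarrow> y \<in> D \<Longrightarrow> x \<in> seg x y"
  by (simp add: seg_def iv_left[OF tree] limV_in)

lemma seg_right: "x \<in> D \<Longrightarrow> y \<in> D \<Longrightarrow> y \<in> seg x y"
  by (simp add: seg_def iv_right[OF tree] limV_in)

lemma seg_mono:
  assumes "x \<in> D" "y \<in> D" "z \<in> seg x y" "w \<in> seg x y"
  shows "seg z w \<subseteq> seg x y"
proof
  fix u assume u: "u \<in> seg z w"
  have "iv (F n) (z n) (w n) \<subseteq> iv (F n) (x n) (y n)" for n
    using assms segD by (intro iv_mono[OF tree] limV_in) auto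
  then show "u \<in> seg x y" using u segD by (intro segI) blast+
qed

lemma closedin_seg: "closedin X (seg x y)"
  unfolding seg_def by (rule closedin_coords)

lemma neq_level:
  assumes "z \<in> D" "w \<in> D" "z \<noteq> w"
  obtains N where "\<And>n. n \<ge> N \<Longrightarrow> z n \<noteq> w n"
proof -
  obtain N where "z N \<noteq> w N" using assms(3) by (auto simp: fun_eq_iff)
  then have "z n \<noteq> w n" if "n \<ge> N" for n using eq_down[OF assms(1,2) _ that] by blast
  then show thesis using that by blast
qed

lemma seg_trans:
  assumes "x \<in> D" "y \<in> D" "z \<in> seg x y" "w \<in> seg x z"
  shows "w \<in> seg x y" "z \<in> seg w y"
proof -
  have "w n \<in> iv (F n) (x n) (y n)" "z n \<in> iv (F n) (w n) (y n)" for n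
    using iv_trans[OF tree limV_in[OF assms(1)] limV_in[OF assms(2)] segD(2)[OF assms(3)] segD(2)[OF assms(4)]]
    by blast+
  then show "w \<in> seg x y" "z \<in> seg w y" using assms segD(1) by (auto intro: segI)
qed

lemma seg_between:
  assumes "x \<in> D" "y \<in> D" "z \<in> seg x y" "p \<in> seg z x" "s \<in> seg z y"
  shows "z \<in> seg p s"
proof -
  have D: "z \<in> D" "p \<in> D" "s \<in> D" using assms segD by auto
  have "z \<in> seg p y" using seg_trans(2)[OF assms(1-3)] assms(4) seg_commute[OF D(1) assms(1)] by blast
  then have "z \<in> seg y p" using seg_commute[OF D(2) assms(2)] by blast
  then have "z \<in> seg s p"
    using seg_trans(2)[OF assms(2) D(2)] assms(5) seg_commute[OF D(1) assms(2)] by blast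
  then show ?thesis using seg_commute[OF D(3,2)] by blast
qed

text \<open>Levelwise \<open>z n\<close> is one of the two ends of an edge, possibly not always the
  same one. Inequality persists upwards, so a point distinct from \<open>p\<close> and
  \<open>s\<close> would differ from both at a common level.\<close>

lemma seg_edge:
  assumes "(p, s) \<in> E" "z \<in> seg p s"
  shows "z = p \<or> z = s"
proof (rule ccontr)
  assume *: "\<not> ?thesis"
  have D: "p \<in> D" "s \<in> D" "z \<in> D" using assms segD by (auto simp: limE_iff)
  obtain M1 where M1: "\<And>n. n \<ge> M1 \<Longrightarrow> z n \<noteq> p n" using neq_level[OF D(3,1)] * by blast
  obtain M2 where M2: "\<And>n. n \<ge> M2 \<Longrightarrow> z n \<noteq> s n" using neq_level[OF D(3,2)] * by blast
  have "z (max M1 M2) \<in> iv (F (max M1 M2)) (p (max M1 M2)) (s (max M1 M2))" using assms(2) segD by blast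
  moreover have "iv (F n) (p n) (s n) = {p n, s n}" for n
    using iv_edge[OF tree] assms(1) by (simp add: limE_iff)
  ultimately show False using M1[of "max M1 M2"] M2[of "max M1 M2"] by auto
qed

lemma iv_successor:
  assumes "a \<in> gV (F n)" "b \<in> gV (F n)" "a \<noteq> b"
  obtains s where "s \<in> iv (F n) a b" "s \<noteq> a" "(a, s) \<in> gE (F n)"
  using gconnected_cross[OF iv_connected[OF tree assms(1,2)] iv_left[OF tree assms(1,2)], of "{a}" b]
    iv_right[OF tree assms(1,2)] assms(3) by auto

text \<open>From level \<open>N\<close> on, nothing else of the path is mapped to
  \<open>z n\<close>. A neighbour of \<open>z (Suc n)\<close> on the way to \<open>y\<close> is thus
  never merged with \<open>z n\<close>, and such neighbours form a thread adjacent to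
  \<open>z\<close> and distinct from it.\<close>

lemma isolated_successor:
  assumes xy: "x \<in> D" "y \<in> D" and z: "z \<in> seg x y" "z \<noteq> y"
    and iso: "\<And>n u. n \<ge> N \<Longrightarrow> u \<in> iv (F (Suc n)) (x (Suc n)) (y (Suc n)) \<Longrightarrow> \<alpha> n u = z n \<Longrightarrow> u = z (Suc n)"
  obtains s where "s \<in> seg z y" "s \<noteq> z" "(z, s) \<in> E"
proof -
  have zD: "z \<in> D" using z(1) segD by blast
  obtain M0 where M0: "\<And>n. n \<ge> M0 \<Longrightarrow> z n \<noteq> y n" using neq_level[OF zD xy(2) z(2)] by blast
  define M where "M = max M0 N"
  have M: "\<And>n. n \<ge> M \<Longrightarrow> z n \<noteq> y n" "\<And>n. n \<ge> M \<Longrightarrow> n \<ge> N" using M0 by (auto simp: M_def)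
  define S where "S n = {s\<in>iv (F n) (z n) (y n). (z n, s) \<in> gE (F n) \<and> (n \<ge> M \<longrightarrow> s \<noteq> z n)}" for n
  have V: "z n \<in> gV (F n)" "y n \<in> gV (F n)" "x n \<in> gV (F n)" for n using zD xy limV_in by auto
  have "\<exists>s\<in>D. \<forall>n. s n \<in> S n"
  proof (rule thread)
    show "S n \<subseteq> gV (F n)" for n using iv_subset[OF tree V(1,2)] by (auto simp: S_def)
    show "S n \<noteq> {}" for n
    proof (cases "n \<ge> M")
      case True
      then show ?thesis using iv_successor[OF V(1,2) M(1)[OF True]] by (auto simp: S_def)
    next
      case False
      then have "z n \<in> S n" using iv_left[OF tree V(1,2)] edge_refl V by (auto simp: S_def)
      then show ?thesis by blast
    qed
    show "\<alpha> n u \<in> S n" if u: "u \<in> S (Suc n)" for n u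
    proof -
      have "\<alpha> n u \<in> iv (F n) (z n) (y n)"
        using tm3_mor_iv[OF mor[of n] V(1,2), of u] u limV_Suc zD xy by (simp add: S_def)
      moreover have "(z n, \<alpha> n u) \<in> gE (F n)"
        using tm3_mor_edge[OF mor[of n], of "z (Suc n)" u] u limV_Suc zD by (simp add: S_def)
      moreover have "\<alpha> n u \<noteq> z n" if "n \<ge> M"
      proof
        assume "\<alpha> n u = z n"
        moreover have "iv (F (Suc n)) (z (Suc n)) (y (Suc n)) \<subseteq> iv (F (Suc n)) (x (Suc n)) (y (Suc n))"
          using V segD(2)[OF z(1)] iv_right[OF tree] by (intro iv_mono[OF tree]) auto
        ultimately have "u = z (Suc n)" using iso[of n u] M(2)[OF that] u by (auto simp: S_def)
        then show False using u that by (simp add: S_def)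
      qed
      ultimately show ?thesis by (simp add: S_def)
    qed
  qed
  then obtain s where s: "s \<in> D" "\<And>n. s n \<in> S n" by blast
  show thesis
  proof (rule that[of s])
    show "s \<in> seg z y" using s by (auto simp: S_def intro: segI)
    show "s \<noteq> z" using s(2)[of M] by (auto simp: S_def)
    show "(z, s) \<in> E" using s zD by (auto simp: S_def limE_iff)
  qed
qed

end

section \<open>Parametrizing a segment by the unit interval\<close>

locale tm3_arc = tm3_trans +
  fixes x y
  assumes x: "x \<in> D" and y: "y \<in> D" and xy: "(x, y) \<notin> E"
    and x_end: "\<And>s. s \<in> seg x y \<Longrightarrow> (x, s) \<in> E \<Longrightarrow> s = x"
    and y_end: "\<And>s. s \<in> seg x y \<Longrightarrow> (y, s) \<in> E \<Longrightarrow> s = y"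
begin

definition P :: "nat \<Rightarrow> nat set" where
  "P n = iv (F n) (x n) (y n)"

text \<open>Initial part of the path, end included; \<open>u \<in> below n v\<close> plays the role
  of u \<le> v in the order of the path.\<close>

definition below :: "nat \<Rightarrow> nat \<Rightarrow> nat set" where
  "below n v = iv (F n) (x n) v"

lemma Vx: "x n \<in> gV (F n)" and Vy: "y n \<in> gV (F n)"
  using x y limV_in by auto

lemma P_subset: "P n \<subseteq> gV (F n)"
  unfolding P_def by (rule iv_subset[OF tree Vx Vy])

lemma finite_P: "finite (P n)"
  using finite_subset[OF P_subset fin] .

lemma x_P: "x n \<in> P n" and y_P: "y n \<in> P n"
  unfolding P_def by (rule iv_left[OF tree Vx Vy], rule iv_right[OF tree Vx Vy])

lemma seg_P: "z \<in> seg x y \<Longrightarrow> z n \<in> P n"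
  by (simp add: P_def segD)

lemma P_down: "u \<in> P (Suc n) \<Longrightarrow> \<alpha> n u \<in> P n"
  using tm3_mor_iv[OF mor Vx Vy] by (simp add: P_def limV_Suc x y)

lemma P_onto: "v \<in> P n \<Longrightarrow> \<exists>u\<in>P (Suc n). \<alpha> n u = v"
  using tm3_mor_iv_onto[OF mor[of n] Vx Vy, of v] by (auto simp: P_def limV_Suc x y)

lemma below_subset: "v \<in> P n \<Longrightarrow> below n v \<subseteq> P n"
  unfolding below_def P_def by (intro iv_mono[OF tree Vx Vy] iv_left[OF tree Vx Vy])

lemma below_self: "v \<in> P n \<Longrightarrow> v \<in> below n v"
  unfolding below_def using P_subset by (intro iv_right[OF tree Vx]) blast

lemma below_linear: "u \<in> P n \<Longrightarrow> v \<in> P n \<Longrightarrow> u \<in> below n v \<or> v \<in> below n u"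
  unfolding below_def P_def by (rule iv_linear[OF tree Vx Vy])

lemma below_antisym: "u \<in> P n \<Longrightarrow> v \<in> P n \<Longrightarrow> u \<in> below n v \<Longrightarrow> v \<in> below n u \<Longrightarrow> u = v"
  unfolding below_def using P_subset by (intro iv_antisym[OF tree Vx]) auto

lemma below_mono: "v \<in> P n \<Longrightarrow> u \<in> below n v \<Longrightarrow> below n u \<subseteq> below n v"
  unfolding below_def using P_subset by (intro iv_mono[OF tree Vx] iv_left[OF tree Vx]) auto

lemma below_down:
  assumes "v \<in> P (Suc n)" "u \<in> below (Suc n) v"
  shows "\<alpha> n u \<in> below n (\<alpha> n v)"
proof -
  have "v \<in> gV (F (Suc n))" using assms(1) P_subset by blast
  then show ?thesis using tm3_mor_iv[OF mor[of n] Vx, of v u] assms by (simp add: below_def limV_Suc x)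
qed

lemma below_step:
  assumes "v \<in> P n" "u \<in> below n v" "(u, v) \<in> gE (F n)"
  shows "below n v = insert v (below n u)"
proof -
  have u: "u \<in> P n" using assms below_subset by blast
  then have V: "u \<in> gV (F n)" "v \<in> gV (F n)" using assms P_subset by auto
  have "below n v = iv (F n) (x n) u \<union> iv (F n) u v"
    using iv_split_Un[OF tree Vx V(2), of u] assms by (simp add: below_def)
  then show ?thesis using iv_edge[OF tree assms(3)] below_self[OF u] by (auto simp: below_def)
qed

lemma below_between:
  assumes "v \<in> P n" "u \<in> below n v" "u \<noteq> v" "(u, v) \<notin> gE (F n)"
  obtains w where "w \<in> P n" "u \<in> below n w" "w \<in> below n v" "w \<noteq> u" "w \<noteq> v"
proof -
  have u: "u \<in> P n" using assms below_subset by blast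
  then have V: "u \<in> gV (F n)" "v \<in> gV (F n)" using assms P_subset by auto
  obtain w where w: "w \<in> iv (F n) u v" "w \<noteq> u" "(u, w) \<in> gE (F n)" using iv_successor[OF V assms(3)] by blast
  have "w \<noteq> v" using w assms(4) by blast
  have wb: "w \<in> below n v" using iv_split_Un[OF tree Vx V(2), of u] assms(2) w by (auto simp: below_def)
  then have "w \<in> P n" using below_subset assms by blast
  then have Vw: "w \<in> gV (F n)" using P_subset by blast
  have "u \<in> below n w"
  proof (rule ccontr)
    assume "u \<notin> below n w"
    then have "w \<in> below n u" using below_linear \<open>w \<in> P n\<close> u by blast
    then show False using iv_split_Int[OF tree Vx V(2), of u] assms(2) w by (auto simp: below_def)
  qed
  then show thesis using that \<open>w \<in> P n\<close> wb w(2) \<open>w \<noteq> v\<close> by blast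
qed

text \<open>The unit mass is distributed over the path \<open>P n\<close>; passing to the next level, the mass of a
  vertex is shared equally by the vertices above it. Since no point of the segment is isolated
  once the ends are chosen suitably, the masses along every thread tend to \<open>0\<close>.\<close>

primrec wt :: "nat \<Rightarrow> nat \<Rightarrow> real" where
  "wt 0 v = 1 / card (P 0)"
| "wt (Suc n) v = wt n (\<alpha> n v) / card {u\<in>P (Suc n). \<alpha> n u = \<alpha> n v}"

declare wt.simps [simp del]

text \<open>\<open>lo n v\<close> and \<open>hi n v\<close> are the ends of the interval that
  \<open>v\<close> occupies when the vertices of the path tile the unit interval in order, each with
  length \<open>wt n v\<close>.\<close>

definition lo :: "nat \<Rightarrow> nat \<Rightarrow> real" where
  "lo n v = sum (wt n) (below n v - {v})"

definition hi :: "nat \<Rightarrow> nat \<Rightarrow> real" where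
  "hi n v = sum (wt n) (below n v)"

lemma wt_pos: "v \<in> P n \<Longrightarrow> wt n v > 0"
proof (induction n arbitrary: v)
  case 0
  then show ?case using finite_P[of 0] by (auto simp: card_gt_0_iff wt.simps)
next
  case (Suc n)
  have "card {u\<in>P (Suc n). \<alpha> n u = \<alpha> n v} > 0"
    using Suc.prems finite_P[of "Suc n"] by (auto simp: card_gt_0_iff)
  then show ?case using Suc.IH[OF P_down[OF Suc.prems]] by (simp add: wt.simps)
qed

lemma wt_fibre:
  assumes "v \<in> P n"
  shows "sum (wt (Suc n)) {u\<in>P (Suc n). \<alpha> n u = v} = wt n v"
proof -
  let ?A = "{u\<in>P (Suc n). \<alpha> n u = v}"
  have "sum (wt (Suc n)) ?A = (\<Sum>u\<in>?A. wt n v / card ?A)" by (intro sum.cong) (auto simp: wt.simps)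
  moreover have "?A \<noteq> {}" "finite ?A" using P_onto[OF assms] finite_P by auto
  ultimately show ?thesis by auto
qed

lemma wt_preimage:
  assumes "T \<subseteq> P n"
  shows "sum (wt (Suc n)) {u\<in>P (Suc n). \<alpha> n u \<in> T} = sum (wt n) T"
proof -
  let ?A = "{u\<in>P (Suc n). \<alpha> n u \<in> T}"
  have "sum (wt (Suc n)) ?A = (\<Sum>v\<in>T. sum (wt (Suc n)) {u\<in>?A. \<alpha> n u = v})"
    using finite_P finite_subset[OF assms finite_P] by (intro sum.group[symmetric]) auto
  also have "\<dots> = (\<Sum>v\<in>T. wt n v)"
  proof (intro sum.cong refl)
    fix v assume v: "v \<in> T"
    then have "{u\<in>?A. \<alpha> n u = v} = {u\<in>P (Suc n). \<alpha> n u = v}" by auto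
    then show "sum (wt (Suc n)) {u\<in>?A. \<alpha> n u = v} = wt n v" using wt_fibre v assms by auto
  qed
  finally show ?thesis .
qed

lemma hi_lo: "v \<in> P n \<Longrightarrow> hi n v = lo n v + wt n v"
  unfolding hi_def lo_def
  using sum.remove[of "below n v" v "wt n"] below_self finite_subset[OF below_subset finite_P] by simp

lemma wt_sum_mono: "A \<subseteq> B \<Longrightarrow> B \<subseteq> P n \<Longrightarrow> sum (wt n) A \<le> sum (wt n) B"
  using finite_subset[OF _ finite_P] less_imp_le[OF wt_pos] by (intro sum_mono2) blast+

lemma total: "sum (wt n) (P n) = 1"
proof (induction n)
  case 0
  have "card (P 0) \<noteq> 0" using x_P[of 0] finite_P[of 0] by auto
  then show ?case by (simp add: wt.simps)
next
  case (Suc n)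
  have "{u\<in>P (Suc n). \<alpha> n u \<in> P n} = P (Suc n)" using P_down by auto
  then show ?case using wt_preimage[of "P n" n] Suc by simp
qed

text \<open>What is mapped strictly before the image of \<open>v\<close> lies strictly before
  \<open>v\<close>. Together with \<open>hi_down\<close> this nests the intervals of a
  thread.\<close>

lemma lo_up:
  assumes v: "v \<in> P (Suc n)"
  shows "lo n (\<alpha> n v) \<le> lo (Suc n) v"
proof -
  have av: "\<alpha> n v \<in> P n" using P_down v by blast
  have "lo n (\<alpha> n v) = sum (wt (Suc n)) {u\<in>P (Suc n). \<alpha> n u \<in> below n (\<alpha> n v) - {\<alpha> n v}}"
    unfolding lo_def using below_subset[OF av] by (intro wt_preimage[symmetric]) auto
  also have "\<dots> \<le> sum (wt (Suc n)) (below (Suc n) v - {v})"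
  proof (rule wt_sum_mono)
    show "{u\<in>P (Suc n). \<alpha> n u \<in> below n (\<alpha> n v) - {\<alpha> n v}} \<subseteq> below (Suc n) v - {v}"
    proof
      fix u assume u: "u \<in> {u\<in>P (Suc n). \<alpha> n u \<in> below n (\<alpha> n v) - {\<alpha> n v}}"
      have "u \<in> below (Suc n) v"
      proof (rule ccontr)
        assume "u \<notin> below (Suc n) v"
        then have "v \<in> below (Suc n) u" using below_linear[of u "Suc n" v] u v by auto
        then have "\<alpha> n v \<in> below n (\<alpha> n u)" using below_down u by auto
        then show False using below_antisym[OF P_down P_down[OF v], of u] u by auto
      qed
      then show "u \<in> below (Suc n) v - {v}" using u by auto
    qed
  qed (use below_subset[OF v] in auto)
  finally show ?thesis by (simp add: lo_def)
qed

lemma hi_down: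
  assumes v: "v \<in> P (Suc n)"
  shows "hi (Suc n) v \<le> hi n (\<alpha> n v)"
proof -
  have av: "\<alpha> n v \<in> P n" using P_down v by blast
  have "hi (Suc n) v \<le> sum (wt (Suc n)) {u\<in>P (Suc n). \<alpha> n u \<in> below n (\<alpha> n v)}"
    unfolding hi_def using below_down[OF v] below_subset[OF v] by (intro wt_sum_mono) auto
  also have "\<dots> = hi n (\<alpha> n v)"
    unfolding hi_def using below_subset[OF av] by (rule wt_preimage)
  finally show ?thesis .
qed

lemma hi_le_lo:
  assumes "v \<in> P n" "u \<in> below n v" "u \<noteq> v"
  shows "hi n u \<le> lo n v"
  unfolding hi_def lo_def
proof (rule wt_sum_mono)
  have "u \<in> P n" using assms below_subset by blast
  then have "v \<notin> below n u" using below_antisym assms by blast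
  then show "below n u \<subseteq> below n v - {v}" using below_mono assms by blast
qed (use below_subset[OF assms(1)] in auto)

lemma lo_x: "lo n (x n) = 0"
proof -
  have "(x n, x n) \<in> gE (F n)" using edge_refl Vx by blast
  then show ?thesis using iv_edge[OF tree, of "x n" "x n" n] by (simp add: lo_def below_def)
qed

lemma hi_y: "hi n (y n) = 1"
  using total[of n] by (simp add: hi_def below_def P_def)

lemma wt_Suc_le:
  assumes "z \<in> seg x y"
  shows "wt (Suc n) (z (Suc n)) \<le> wt n (z n)"
  using lo_up[of "z (Suc n)" n] hi_down[of "z (Suc n)" n] hi_lo[of "z n" n] hi_lo[of "z (Suc n)" "Suc n"]
    seg_P[OF assms] limV_Suc[OF segD(1)[OF assms], of n] by simp

lemma wt_antimono:
  assumes "z \<in> seg x y" "n \<le> m"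
  shows "wt m (z m) \<le> wt n (z n)"
  using assms(2) by (induction m rule: dec_induct) (simp, meson order_trans wt_Suc_le[OF assms(1)])

text \<open>\<open>isolated_successor\<close> is applied towards both ends of the segment. If
  \<open>z\<close> is an end, the one adjacent point obtained contradicts \<open>x_end\<close> or
  \<open>y_end\<close>; otherwise the two points obtained are adjacent by transitivity and
  contradict \<open>seg_edge\<close>.\<close>

lemma not_isolated:
  assumes z: "z \<in> seg x y"
  shows "\<exists>n\<ge>N. \<exists>u\<in>P (Suc n). \<alpha> n u = z n \<and> u \<noteq> z (Suc n)"
proof (rule ccontr)
  assume *: "\<not> ?thesis"
  have zD: "z \<in> D" using z segD by blast
  have iso: "\<And>n u. n \<ge> N \<Longrightarrow> u \<in> P (Suc n) \<Longrightarrow> \<alpha> n u = z n \<Longrightarrow> u = z (Suc n)" using * by blast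
  have iso': "\<And>n u. n \<ge> N \<Longrightarrow> u \<in> iv (F (Suc n)) (y (Suc n)) (x (Suc n)) \<Longrightarrow> \<alpha> n u = z n \<Longrightarrow> u = z (Suc n)"
    using iso iv_commute[OF tree Vx Vy] unfolding P_def by metis
  have sy: "\<exists>s. s \<in> seg z y \<and> s \<noteq> z \<and> (z, s) \<in> E" if "z \<noteq> y"
    using isolated_successor[OF x y z that iso[unfolded P_def]] by blast
  have z': "z \<in> seg y x" using z seg_commute x y by blast
  have sx: "\<exists>s. s \<in> seg z x \<and> s \<noteq> z \<and> (z, s) \<in> E" if "z \<noteq> x"
    using isolated_successor[OF y x z' that iso'] by blast
  have "x \<noteq> y" using xy limE_refl x by blast
  then consider "z = x" "z \<noteq> y" | "z = y" "z \<noteq> x" | "z \<noteq> x" "z \<noteq> y" by blast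
  then show False
  proof cases
    case 1
    then show False using sy x_end by blast
  next
    case 2
    then show False using sx y_end seg_commute[OF x y] by blast
  next
    case 3
    obtain s where s: "s \<in> seg z y" "s \<noteq> z" "(z, s) \<in> E" using sy 3 by blast
    obtain p where p: "p \<in> seg z x" "p \<noteq> z" "(z, p) \<in> E" using sx 3 by blast
    have "(p, s) \<in> E" using limE_trans limE_sym s(3) p(3) by blast
    moreover have "z \<in> seg p s" using seg_between x y z p(1) s(1) by blast
    ultimately show False using seg_edge s(2) p(2) by blast
  qed
qed

text \<open>Whenever \<open>z n\<close> has a second vertex of the path above it, its mass is shared
  by at least two vertices; by \<open>not_isolated\<close> this happens at arbitrarily late
  levels.\<close>

lemma wt_halves:
  assumes z: "z \<in> seg x y"
  shows "\<exists>n. wt n (z n) \<le> (1/2) ^ k"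
proof (induction k)
  case 0
  have "wt 0 (z 0) \<le> 1"
    using wt_sum_mono[of "{z 0}" "P 0" 0] total[of 0] seg_P[OF z, of 0] by simp
  then show ?case by (intro exI[of _ 0]) simp
next
  case (Suc k)
  then obtain N where N: "wt N (z N) \<le> (1/2) ^ k" by blast
  obtain n u where n: "n \<ge> N" "u \<in> P (Suc n)" "\<alpha> n u = z n" "u \<noteq> z (Suc n)"
    using not_isolated[OF z] by blast
  have az: "\<alpha> n (z (Suc n)) = z n" using limV_Suc z segD by blast
  let ?A = "{v\<in>P (Suc n). \<alpha> n v = z n}"
  have "card {u, z (Suc n)} \<le> card ?A"
    using n az seg_P[OF z] finite_P by (intro card_mono) auto
  then have "real (card ?A) \<ge> 2" using n by simp
  moreover have "wt n (z n) > 0" using wt_pos seg_P z by blast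
  ultimately have "wt n (z n) / real (card ?A) \<le> wt n (z n) / 2" by (intro divide_left_mono) auto
  then have "wt (Suc n) (z (Suc n)) \<le> wt n (z n) / 2" using az by (simp add: wt.simps)
  also have "\<dots> \<le> (1/2) ^ Suc k" using wt_antimono[OF z n(1)] N by simp
  finally show ?case by blast
qed

lemma wt_small:
  assumes "z \<in> seg x y" "e > 0"
  obtains N where "\<And>n. n \<ge> N \<Longrightarrow> wt n (z n) < e"
proof -
  obtain k where "(1/2) ^ k < e" using real_arch_pow_inv[OF assms(2), of "1/2"] by auto
  then obtain N where "wt N (z N) < e" using wt_halves[OF assms(1)] by (meson le_less_trans)
  then show thesis using that[of N] wt_antimono[OF assms(1)] le_less_trans by blast
qed

text \<open>The common point of the nested intervals of the thread \<open>z\<close>, taken as the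
  supremum of their left ends.\<close>

definition phi :: "(nat \<Rightarrow> nat) \<Rightarrow> real" where
  "phi z = (SUP n. lo n (z n))"

lemma lo_incseq:
  assumes "z \<in> seg x y" "n \<le> m"
  shows "lo n (z n) \<le> lo m (z m)"
  using assms(2)
proof (induction m rule: dec_induct)
  case (step m)
  then show ?case
    using lo_up[of "z (Suc m)" m] seg_P[OF assms(1)] limV_Suc[OF segD(1)[OF assms(1)], of m] by simp
qed simp

lemma hi_decseq:
  assumes "z \<in> seg x y" "n \<le> m"
  shows "hi m (z m) \<le> hi n (z n)"
  using assms(2)
proof (induction m rule: dec_induct)
  case (step m)
  then show ?case
    using hi_down[of "z (Suc m)" m] seg_P[OF assms(1)] limV_Suc[OF segD(1)[OF assms(1)], of m] by simp
qed simp

lemma lo_le_hi: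
  assumes "z \<in> seg x y"
  shows "lo n (z n) \<le> hi m (z m)"
proof -
  let ?k = "max n m"
  have "lo n (z n) \<le> lo ?k (z ?k)" "hi ?k (z ?k) \<le> hi m (z m)"
    using lo_incseq[OF assms] hi_decseq[OF assms] by auto
  moreover have "lo ?k (z ?k) \<le> hi ?k (z ?k)"
    using hi_lo[OF seg_P[OF assms], of ?k] wt_pos[OF seg_P[OF assms], of ?k] by simp
  ultimately show ?thesis by linarith
qed

lemma lo_le_phi: "z \<in> seg x y \<Longrightarrow> lo n (z n) \<le> phi z"
  unfolding phi_def using lo_le_hi[of z _ 0] by (intro cSUP_upper bdd_aboveI2) auto

lemma phi_le_hi: "z \<in> seg x y \<Longrightarrow> phi z \<le> hi n (z n)"
  unfolding phi_def using lo_le_hi by (intro cSUP_least) auto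

text \<open>Adjacent vertices of the path occupy intervals with a common end, and \<open>phi\<close>
  takes its values inside them. The estimate serves twice: for continuity, with equal vertices at a
  deep level, and for the equality of parameters of adjacent points.\<close>

lemma phi_close:
  assumes "z \<in> seg x y" "w \<in> seg x y" "z n = w n \<or> (z n, w n) \<in> gE (F n)"
  shows "\<bar>phi z - phi w\<bar> \<le> wt n (z n) + wt n (w n)"
proof -
  have *: "\<bar>phi z - phi w\<bar> \<le> wt n (z n) + wt n (w n)"
    if zw: "z \<in> seg x y" "w \<in> seg x y" and b: "z n \<in> below n (w n)" and e: "(z n, w n) \<in> gE (F n)" for z w
  proof -
    have P: "z n \<in> P n" "w n \<in> P n" using zw seg_P by auto
    have h: "hi n (w n) \<le> hi n (z n) + wt n (w n)"
      unfolding hi_def below_step[OF P(2) b e]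
      using finite_subset[OF below_subset finite_P, OF P(1)] wt_pos[OF P(2)] by (simp add: sum.insert_if)
    have l: "lo n (z n) \<le> lo n (w n)"
    proof (cases "z n = w n")
      case False
      then show ?thesis using hi_le_lo[OF P(2) b] hi_lo[OF P(1)] wt_pos[OF P(1)] by simp
    qed simp
    show ?thesis
      using h l lo_le_phi[OF zw(1), of n] lo_le_phi[OF zw(2), of n] phi_le_hi[OF zw(1), of n] phi_le_hi[OF zw(2), of n]
        hi_lo[OF P(1)] hi_lo[OF P(2)] wt_pos[OF P(1)] wt_pos[OF P(2)] by linarith
  qed
  have e: "(z n, w n) \<in> gE (F n)" "(w n, z n) \<in> gE (F n)"
    using assms edge_refl edge_sym P_subset seg_P by (metis subsetD)+
  have "z n \<in> below n (w n) \<or> w n \<in> below n (z n)" using below_linear seg_P assms by blast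
  then show ?thesis using *[OF assms(1,2) _ e(1)] *[OF assms(2,1) _ e(2)] by (auto simp: abs_minus_commute add.commute)
qed

lemma phi_eq:
  assumes "z \<in> seg x y" "w \<in> seg x y" "(z, w) \<in> E"
  shows "phi z = phi w"
proof (rule ccontr)
  assume "phi z \<noteq> phi w"
  then have e: "\<bar>phi z - phi w\<bar> / 2 > 0" by simp
  obtain N1 where N1: "\<And>n. n \<ge> N1 \<Longrightarrow> wt n (z n) < \<bar>phi z - phi w\<bar> / 2" using wt_small[OF assms(1) e] by blast
  obtain N2 where N2: "\<And>n. n \<ge> N2 \<Longrightarrow> wt n (w n) < \<bar>phi z - phi w\<bar> / 2" using wt_small[OF assms(2) e] by blast
  have "\<bar>phi z - phi w\<bar> \<le> wt (max N1 N2) (z (max N1 N2)) + wt (max N1 N2) (w (max N1 N2))"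
    using assms by (intro phi_close) (auto simp: limE_iff)
  moreover have "wt (max N1 N2) (z (max N1 N2)) < \<bar>phi z - phi w\<bar> / 2" by (intro N1) simp
  moreover have "wt (max N1 N2) (w (max N1 N2)) < \<bar>phi z - phi w\<bar> / 2" by (intro N2) simp
  ultimately show False by linarith
qed

text \<open>Between two non-adjacent vertices of the path there is a third one, and its positive
  mass keeps the parameters apart.\<close>

lemma phi_inj:
  assumes "z \<in> seg x y" "w \<in> seg x y" "phi z = phi w"
  shows "(z, w) \<in> E"
proof (rule ccontr)
  assume "(z, w) \<notin> E"
  then obtain n where n: "(z n, w n) \<notin> gE (F n)" using assms segD by (auto simp: limE_iff)
  have *: "phi z < phi w" if zw: "z \<in> seg x y" "w \<in> seg x y" and b: "z n \<in> below n (w n)"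
    and e: "(z n, w n) \<notin> gE (F n)" for z w
  proof -
    have P: "z n \<in> P n" "w n \<in> P n" using zw seg_P by auto
    have "z n \<noteq> w n" using e edge_refl P P_subset by (metis subsetD)
    then obtain u where u: "u \<in> P n" "z n \<in> below n u" "u \<in> below n (w n)" "u \<noteq> z n" "u \<noteq> w n"
      using below_between[OF P(2) b _ e] by blast
    show ?thesis
      using hi_le_lo[OF u(1,2)] hi_le_lo[OF P(2) u(3)] u(4,5) hi_lo[OF u(1)] wt_pos[OF u(1)]
        phi_le_hi[OF zw(1), of n] lo_le_phi[OF zw(2), of n] by linarith
  qed
  have "z n \<in> below n (w n) \<or> w n \<in> below n (z n)" using below_linear seg_P assms by blast
  then show False using *[OF assms(1,2) _ n] *[OF assms(2,1)] n edge_sym assms(3) by fastforce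
qed

text \<open>The last vertex whose interval starts at or before \<open>t\<close> works, since the
  interval of its successor starts where its own ends.\<close>

lemma lo_hi_cover:
  assumes "0 \<le> t" "t \<le> 1"
  shows "\<exists>u\<in>P n. lo n u \<le> t \<and> t \<le> hi n u"
proof -
  let ?U = "{u\<in>P n. lo n u \<le> t}"
  have fU: "finite ?U" and neU: "x n \<in> ?U" using finite_P x_P lo_x assms by auto
  have "Max (lo n ` ?U) \<in> lo n ` ?U" using fU neU by (intro Max_in) auto
  then obtain u where u0: "u \<in> ?U" "Max (lo n ` ?U) = lo n u" by blast
  have u: "u \<in> ?U" "\<And>v. v \<in> ?U \<Longrightarrow> lo n v \<le> lo n u"
    using u0(1) Max_ge[of "lo n ` ?U"] fU unfolding u0(2) by auto
  then have uP: "u \<in> P n" by simp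
  have "t \<le> hi n u"
  proof (rule ccontr)
    assume t: "\<not> t \<le> hi n u"
    then have "u \<noteq> y n" using hi_y assms by auto
    have Vu: "u \<in> gV (F n)" using uP P_subset by blast
    obtain v where v: "v \<in> iv (F n) u (y n)" "v \<noteq> u" "(u, v) \<in> gE (F n)"
      using iv_successor[OF Vu Vy \<open>u \<noteq> y n\<close>] by blast
    have vP: "v \<in> P n" using iv_split_Un[OF tree Vx Vy, of u] uP v unfolding P_def by blast
    have b: "u \<in> below n v"
    proof (rule ccontr)
      assume "u \<notin> below n v"
      then have "v \<in> below n u" using below_linear vP uP by blast
      then show False
        using iv_split_Int[OF tree Vx Vy, of u] uP v by (auto simp: below_def P_def)
    qed
    have "v \<notin> below n u" using below_antisym b uP vP v by blast
    then have "lo n v = hi n u" unfolding lo_def hi_def below_step[OF vP b v(3)] by simp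
    then have "v \<in> ?U" using t vP by simp
    then show False using u(2)[of v] \<open>lo n v = hi n u\<close> hi_lo[OF uP] wt_pos[OF uP] by linarith
  qed
  then show ?thesis using u by blast
qed

text \<open>By nesting, vertices whose interval contains \<open>t\<close> are mapped to such
  vertices, so there is a thread through them; its intervals shrink to \<open>t\<close>.\<close>

lemma phi_surj:
  assumes t: "0 \<le> t" "t \<le> 1"
  obtains z where "z \<in> seg x y" "phi z = t"
proof -
  have "\<exists>z\<in>D. \<forall>n. z n \<in> {u\<in>P n. lo n u \<le> t \<and> t \<le> hi n u}"
  proof (rule thread)
    show "{u\<in>P n. lo n u \<le> t \<and> t \<le> hi n u} \<subseteq> gV (F n)" for n using P_subset by blast
    show "{u\<in>P n. lo n u \<le> t \<and> t \<le> hi n u} \<noteq> {}" for n using lo_hi_cover[OF t] by blast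
    show "\<alpha> n u \<in> {u\<in>P n. lo n u \<le> t \<and> t \<le> hi n u}"
      if "u \<in> {u\<in>P (Suc n). lo (Suc n) u \<le> t \<and> t \<le> hi (Suc n) u}" for n u
      using that P_down lo_up[of u n] hi_down[of u n] by auto
  qed
  then obtain z where z: "z \<in> D" "\<And>n. z n \<in> {u\<in>P n. lo n u \<le> t \<and> t \<le> hi n u}" by blast
  have zs: "z \<in> seg x y" using z by (intro segI) (auto simp: P_def)
  have "phi z = t"
  proof (rule ccontr)
    assume "phi z \<noteq> t"
    then obtain N where N: "\<And>n. n \<ge> N \<Longrightarrow> wt n (z n) < \<bar>phi z - t\<bar>" using wt_small[OF zs, of "\<bar>phi z - t\<bar>"] by auto
    have "z N \<in> P N" "lo N (z N) \<le> t" "t \<le> hi N (z N)" using z(2)[of N] by auto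
    then show False using N[of N] lo_le_phi[OF zs, of N] phi_le_hi[OF zs, of N] hi_lo[of "z N" N] by linarith
  qed
  then show thesis using that zs by blast
qed

lemma phi_x: "phi x = 0"
  unfolding phi_def by (simp add: lo_x)

lemma phi_y: "phi y = 1"
proof (rule antisym)
  have ys: "y \<in> seg x y" using seg_right x y by blast
  show "phi y \<le> 1" using phi_le_hi[OF ys, of 0] hi_y by simp
  show "1 \<le> phi y"
  proof (rule ccontr)
    assume "\<not> 1 \<le> phi y"
    then obtain N where N: "\<And>n. n \<ge> N \<Longrightarrow> wt n (y n) < 1 - phi y" using wt_small[OF ys, of "1 - phi y"] by auto
    show False using N[of N] lo_le_phi[OF ys, of N] hi_lo[OF y_P, of N] hi_y[of N] by simp
  qed
qed

lemma phi_range: "phi ` seg x y = {0..1}"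
proof
  show "phi ` seg x y \<subseteq> {0..1}"
  proof
    fix t assume "t \<in> phi ` seg x y"
    then obtain z where z: "z \<in> seg x y" "t = phi z" by blast
    have P: "z 0 \<in> P 0" using seg_P z by blast
    have "0 \<le> lo 0 (z 0)"
      unfolding lo_def using wt_pos[of _ 0] below_subset[OF P] by (intro sum_nonneg) (auto intro: less_imp_le)
    moreover have "hi 0 (z 0) \<le> 1"
      unfolding hi_def total[of 0, symmetric] using below_subset[OF P] by (intro wt_sum_mono) auto
    ultimately show "t \<in> {0..1}" using lo_le_phi[OF z(1), of 0] phi_le_hi[OF z(1), of 0] z(2) by auto
  qed
  show "{0..1} \<subseteq> phi ` seg x y"
  proof
    fix t :: real assume "t \<in> {0..1}"
    then show "t \<in> phi ` seg x y" using phi_surj[of t] by auto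
  qed
qed

lemma phi_continuous: "continuous_map (subtopology X (seg x y)) (top_of_set {0..1}) phi"
proof -
  let ?S = "subtopology X (seg x y)"
  have sub: "seg x y \<subseteq> D" using segD by blast
  have ts: "topspace ?S = seg x y" using sub by auto
  have "openin ?S {z\<in>seg x y. phi z \<in> U}" if "open U" for U
    unfolding openin_subopen[of ?S "{z\<in>seg x y. phi z \<in> U}"]
  proof
    fix z assume z: "z \<in> {z\<in>seg x y. phi z \<in> U}"
    then obtain e where e: "e > 0" "\<And>t. \<bar>t - phi z\<bar> < e \<Longrightarrow> t \<in> U"
      using \<open>open U\<close> by (auto simp: open_dist dist_real_def)
    obtain n where n: "wt n (z n) < e / 2" using wt_small[of z "e / 2"] z e(1) by auto
    let ?T = "seg x y \<inter> {w\<in>D. w n = z n}"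
    have "openin ?S ?T" using openin_cyl[of "\<lambda>a. a = z n" n] by (rule openin_subtopology_Int2)
    moreover have "z \<in> ?T" using z sub by auto
    moreover have "?T \<subseteq> {z\<in>seg x y. phi z \<in> U}"
    proof
      fix w assume w: "w \<in> ?T"
      then have "\<bar>phi w - phi z\<bar> \<le> wt n (w n) + wt n (z n)" using z by (intro phi_close) auto
      then show "w \<in> {z\<in>seg x y. phi z \<in> U}" using w n e(2) by auto
    qed
    ultimately show "\<exists>T. openin ?S T \<and> z \<in> T \<and> T \<subseteq> {z\<in>seg x y. phi z \<in> U}" by blast
  qed
  then have "continuous_map ?S euclideanreal phi" unfolding continuous_map_def ts by auto
  then show ?thesis using phi_range by (auto simp: continuous_map_in_subtopology ts)
qed

text \<open>By compactness \<open>phi\<close> is a quotient map of the segment onto the unit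
  interval, so \<open>q\<close> factors through it by \<open>phi_inj\<close>. The factor is
  injective by \<open>phi_eq\<close>, hence an embedding of the compact interval into a Hausdorff
  space.\<close>

lemma arc: "\<exists>g. arc_in Y g \<and> g 0 = q x \<and> g 1 = q y \<and> g ` {0..1} \<subseteq> q ` seg x y"
proof -
  let ?S = "subtopology X (seg x y)"
  have sub: "seg x y \<subseteq> D" using segD by blast
  have ts: "topspace ?S = seg x y" using sub by auto
  have "compactin X (seg x y)" using closedin_compact_space[OF compact_X closedin_seg] .
  then have "compact_space ?S" by (rule compact_space_subtopology)
  then have "quotient_map ?S (top_of_set {0..1}) phi"
    using phi_continuous phi_range ts
    by (intro continuous_imp_quotient_map) (auto intro: Hausdorff_space_subtopology)
  moreover have "continuous_map ?S Y q" using continuous_q by (rule continuous_map_from_subtopology)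
  moreover have "q z = q w" if "z \<in> topspace ?S" "w \<in> topspace ?S" "phi z = phi w" for z w
    using that phi_inj[of z w] q_eq sub unfolding ts by blast
  ultimately obtain g where g: "continuous_map (top_of_set {0..1}) Y g" "g ` topspace (top_of_set {0..1}) = q ` topspace ?S"
    "\<And>z. z \<in> topspace ?S \<Longrightarrow> g (phi z) = q z"
    by (rule quotient_map_lift_exists) (assumption | rule that)+
  have gq: "g (phi z) = q z" if "z \<in> seg x y" for z using g(3) that ts by blast
  have "inj_on g {0..1}"
  proof (rule inj_onI)
    fix s t :: real assume st: "s \<in> {0..1}" "t \<in> {0..1}" "g s = g t"
    then have "s \<in> phi ` seg x y" "t \<in> phi ` seg x y" by (simp_all add: phi_range)
    then obtain z w where zw: "z \<in> seg x y" "w \<in> seg x y" "s = phi z" "t = phi w" by blast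
    then have "(z, w) \<in> E" using gq st(3) q_eq[of z w] sub by auto
    then show "s = t" using phi_eq zw by blast
  qed
  then have "embedding_map (top_of_set {0..1}) Y g"
    using g(1) Hausdorff_Y by (intro continuous_imp_embedding_map) (auto simp: compact_space_subtopology)
  moreover have "g 0 = q x" "g 1 = q y"
    using gq[OF seg_left[OF x y]] gq[OF seg_right[OF x y]] phi_x phi_y by auto
  moreover have "g ` {0..1} \<subseteq> q ` seg x y" using g(2) ts by auto
  ultimately show ?thesis unfolding arc_in_def by blast
qed

end

section \<open>The projective Fraisse limit\<close>

context tm3_trans
begin

text \<open>One move suffices: a neighbour \<open>s\<close> of \<open>x'\<close> further along the
  segment would by transitivity be adjacent to \<open>x\<close>, with \<open>x'\<close> between
  them, so \<open>seg_edge\<close> gives \<open>s = x'\<close>.\<close>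

lemma good_end:
  assumes "x \<in> D" "y \<in> D"
  shows "\<exists>x'\<in>seg x y. (x, x') \<in> E \<and> (\<forall>s\<in>seg x' y. (x', s) \<in> E \<longrightarrow> s = x')"
proof (cases "\<forall>s\<in>seg x y. (x, s) \<in> E \<longrightarrow> s = x")
  case True
  then show ?thesis using seg_left[OF assms] limE_refl[OF assms(1)] by blast
next
  case False
  then obtain x' where x': "x' \<in> seg x y" "(x, x') \<in> E" "x' \<noteq> x" by blast
  have D: "x' \<in> D" using x' segD by blast
  have "s = x'" if s: "s \<in> seg x' y" "(x', s) \<in> E" for s
  proof -
    have "x' \<in> seg x s"
      using seg_between[OF assms x'(1) seg_right[OF D assms(1)] s(1)] .
    then show ?thesis using seg_edge[of x s x'] limE_trans x' s(2) by blast
  qed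
  then show ?thesis using x' by blast
qed

lemma arc_exists:
  assumes "x \<in> D" "y \<in> D" "(x, y) \<notin> E"
  shows "\<exists>g. arc_in Y g \<and> g 0 = q x \<and> g 1 = q y \<and> g ` {0..1} \<subseteq> q ` seg x y"
proof -
  obtain x' where x': "x' \<in> seg x y" "(x, x') \<in> E" "\<And>s. s \<in> seg x' y \<Longrightarrow> (x', s) \<in> E \<Longrightarrow> s = x'"
    using good_end[OF assms(1,2)] by blast
  have D': "x' \<in> D" using x' segD by blast
  \<comment> \<open>The second end is chosen in the segment already shortened at \<open>x'\<close>,
    so that the property of \<open>x'\<close> persists in the still smaller segment.\<close>
  obtain y' where y': "y' \<in> seg y x'" "(y, y') \<in> E" "\<And>s. s \<in> seg y' x' \<Longrightarrow> (y', s) \<in> E \<Longrightarrow> s = y'"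
    using good_end[OF assms(2) D'] by blast
  have D'': "y' \<in> D" using y' segD by blast
  have y'x': "y' \<in> seg x' y" using y'(1) seg_commute[OF assms(2) D'] by blast
  have sub1: "seg x' y' \<subseteq> seg x' y" using seg_mono[OF D' assms(2) seg_left[OF D' assms(2)] y'x'] .
  have sub2: "seg x' y \<subseteq> seg x y" using seg_mono[OF assms(1,2) x'(1) seg_right[OF assms(1,2)]] .
  interpret tm3_arc F \<alpha> x' y'
  proof
    show "(x', y') \<notin> E" using assms(3) x'(2) y'(2) limE_trans limE_sym by blast
    show "\<And>s. s \<in> seg x' y' \<Longrightarrow> (x', s) \<in> E \<Longrightarrow> s = x'" using x'(3) sub1 by blast
    show "\<And>s. s \<in> seg x' y' \<Longrightarrow> (y', s) \<in> E \<Longrightarrow> s = y'" using y'(3) seg_commute[OF D' D''] by blast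
  qed (use D' D'' in auto)
  have "q x' = q x" "q y' = q y" using q_eq x'(2) y'(2) D' D'' assms limE_sym by blast+
  moreover obtain g where "arc_in Y g" "g 0 = q x'" "g 1 = q y'" "g ` {0..1} \<subseteq> q ` seg x' y'"
    using arc by blast
  moreover from this have "g ` {0..1} \<subseteq> q ` seg x y" using sub1 sub2 by blast
  ultimately show ?thesis by auto
qed

lemma arcwise_connected_Y: "arcwise_connected Y"
  unfolding arcwise_connected_def topspace_Y
proof (intro ballI impI)
  fix a b assume ab: "a \<in> q ` D" "b \<in> q ` D" "a \<noteq> b"
  then obtain x y where xy: "x \<in> D" "y \<in> D" "a = q x" "b = q y" by blast
  then have "(x, y) \<notin> E" using ab q_eq by blast
  then show "\<exists>g. arc_in Y g \<and> g 0 = a \<and> g 1 = b" using arc_exists[OF xy(1,2)] xy by blast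
qed

lemma dendrite_Y: "dendrite Y"
  unfolding dendrite_def
  by (intro conjI continuum_Y locally_connected_Y hereditarily_unicoherent_Y arcwise_connected_Y)

text \<open>A point common to two of the arcs comes from adjacent points \<open>u\<close> and
  \<open>w\<close> on two segments issuing from \<open>r\<close>. Since \<open>r\<close> lies
  between them, \<open>seg_edge\<close> identifies it with one of them.\<close>

lemma ramification_median:
  assumes D: "x1 \<in> D" "x2 \<in> D" "x3 \<in> D"
    and r: "r \<in> seg x1 x2" "r \<in> seg x2 x3" "r \<in> seg x1 x3"
    and ne: "(r, x1) \<notin> E" "(r, x2) \<notin> E" "(r, x3) \<notin> E"
  shows "ramification_point Y (q r)"
proof -
  have rD: "r \<in> D" using r segD by blast
  have meet: "g ` {0..1} \<inter> h ` {0..1} = {q r}"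
    if "a \<in> D" "b \<in> D" "r \<in> seg a b" "g ` {0..1} \<subseteq> q ` seg r a" "h ` {0..1} \<subseteq> q ` seg r b"
      "g 0 = q r" "h 0 = q r" for a b and g h :: "real \<Rightarrow> (nat \<Rightarrow> nat) set"
  proof
    have "g 0 \<in> g ` {0..1}" "h 0 \<in> h ` {0..1}" by simp_all
    then have "q r \<in> g ` {0..1}" "q r \<in> h ` {0..1}" unfolding that(6,7) .
    then show "{q r} \<subseteq> g ` {0..1} \<inter> h ` {0..1}" by blast
    show "g ` {0..1} \<inter> h ` {0..1} \<subseteq> {q r}"
    proof
      fix p assume "p \<in> g ` {0..1} \<inter> h ` {0..1}"
      then have "p \<in> q ` seg r a" "p \<in> q ` seg r b" using that(4,5) by blast+
      then obtain u w where uw: "u \<in> seg r a" "w \<in> seg r b" "p = q u" "p = q w" by blast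
      then have "(u, w) \<in> E" using q_eq[of u w] segD(1) by simp
      moreover have "r \<in> seg u w" using seg_between that uw by blast
      ultimately have "r = u \<or> r = w" by (rule seg_edge)
      then show "p \<in> {q r}" using uw by auto
    qed
  qed
  obtain g1 where g1: "arc_in Y g1" "g1 0 = q r" "g1 ` {0..1} \<subseteq> q ` seg r x1"
    using arc_exists[OF rD D(1) ne(1)] by blast
  obtain g2 where g2: "arc_in Y g2" "g2 0 = q r" "g2 ` {0..1} \<subseteq> q ` seg r x2"
    using arc_exists[OF rD D(2) ne(2)] by blast
  obtain g3 where g3: "arc_in Y g3" "g3 0 = q r" "g3 ` {0..1} \<subseteq> q ` seg r x3"
    using arc_exists[OF rD D(3) ne(3)] by blast
  have "g1 ` {0..1} \<inter> g2 ` {0..1} = {q r}" "g1 ` {0..1} \<inter> g3 ` {0..1} = {q r}"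
    "g2 ` {0..1} \<inter> g3 ` {0..1} = {q r}"
    using meet[OF D(1,2) r(1) g1(3) g2(3) g1(2) g2(2)] meet[OF D(1,3) r(3) g1(3) g3(3) g1(2) g3(2)]
      meet[OF D(2,3) r(2) g2(3) g3(3) g2(2) g3(2)] by blast+
  then show ?thesis unfolding ramification_point_def using g1 g2 g3 by blast
qed

end

context tm3_seq
begin

text \<open>At each level the vertices common to the three intervals form a nonempty set by
  \<open>iv_median\<close>, and the bonding maps preserve these sets.\<close>

lemma seg_median:
  assumes D: "a \<in> D" "b \<in> D" "c \<in> D"
  shows "\<exists>r. r \<in> seg a b \<and> r \<in> seg b c \<and> r \<in> seg a c"
proof -
  let ?S = "\<lambda>n. iv (F n) (a n) (b n) \<inter> iv (F n) (b n) (c n) \<inter> iv (F n) (a n) (c n)"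
  have V: "a n \<in> gV (F n)" "b n \<in> gV (F n)" "c n \<in> gV (F n)" for n using D limV_in by auto
  have "\<exists>r\<in>D. \<forall>n. r n \<in> ?S n"
  proof (rule thread)
    show "?S n \<subseteq> gV (F n)" for n using iv_subset[OF tree V(1,2)] by blast
    show "?S n \<noteq> {}" for n using iv_median[OF tree V] .
    have "\<alpha> n u \<in> iv (F n) (x n) (y n)"
      if "u \<in> iv (F (Suc n)) (x (Suc n)) (y (Suc n))" "x \<in> D" "y \<in> D" for n u x y
      using tm3_mor_iv[OF mor[of n] limV_in[OF that(2)] limV_in[OF that(3)] that(1)]
      by (simp add: limV_Suc that)
    then show "\<alpha> n u \<in> ?S n" if "u \<in> ?S (Suc n)" for n u using that D by blast
  qed
  then show ?thesis by (auto simp: seg_def)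
qed

end

locale tm3_fraisse =
  fixes F :: "nat \<Rightarrow> fgraph" and \<alpha> :: "nat \<Rightarrow> nat \<Rightarrow> nat"
  assumes fraisse: "tm3_fraisse_limit F \<alpha>"
begin

sublocale tm3_seq
  using fraisse by unfold_locales (simp add: tm3_fraisse_limit_def)

lemma refine:
  assumes "tm3_mor B (F n) g"
  obtains h where "fomega_epi F \<alpha> B h" "\<And>z. z \<in> D \<Longrightarrow> z n = g (h z)"
proof -
  have "tm3_obj (F n) \<and> tm3_obj B \<and> fomega_epi F \<alpha> (F n) (\<lambda>z. z n) \<and> tm3_mor B (F n) g"
    using assms obj fomega_proj tm3_mor_obj by blast
  then have "\<exists>h. fomega_epi F \<alpha> B h \<and> (\<forall>z\<in>D. z n = g (h z))"
    using fraisse unfolding tm3_fraisse_limit_def by blast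
  then show thesis using that by blast
qed

text \<open>If \<open>x\<close>, \<open>y\<close>, \<open>z\<close> were adjacent in this order without \<open>x\<close>, \<open>z\<close> being adjacent, then subdividing the
  edge between the images of \<open>x\<close> and \<open>y\<close> would force the image of \<open>y\<close> to be the new vertex, which
  has no neighbour that could be the image of \<open>z\<close>.\<close>

lemma trans_E: "trans E"
proof (rule transI)
  fix x y z assume xy: "(x, y) \<in> E" and yz: "(y, z) \<in> E"
  have D: "x \<in> D" "y \<in> D" "z \<in> D" using xy yz by (auto simp: limE_iff)
  show "(x, z) \<in> E"
  proof (rule ccontr)
    assume "(x, z) \<notin> E"
    then obtain n where n: "(x n, z n) \<notin> gE (F n)" using D by (auto simp: limE_iff)
    have e: "(y n, x n) \<in> gE (F n)" "(y n, z n) \<in> gE (F n)" "(x n, y n) \<in> gE (F n)"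
      using xy yz edge_sym by (auto simp: limE_iff)
    have yx: "y n \<noteq> x n" using e n by metis
    have V: "x n \<in> gV (F n)" "y n \<in> gV (F n)" "z n \<in> gV (F n)" using D limV_in by auto
    obtain v where v: "v \<notin> gV (F n)" using ex_new_if_finite[OF infinite_UNIV_nat fin] by blast
    let ?B = "subdiv (F n) (y n) (x n) v"
    obtain h where h: "fomega_epi F \<alpha> ?B h" "\<And>u. u \<in> D \<Longrightarrow> u n = collapse (y n) v (h u)"
      using refine[OF subdiv_tm3_mor[OF obj e(1) yx v]] by blast
    have hE: "(h x, h y) \<in> gE ?B" "(h y, h z) \<in> gE ?B"
      using h(1) xy yz unfolding fomega_epi_def by blast+
    have hx: "h x = x n" using h(2)[OF D(1)] yx by (auto simp: collapse_def split: if_splits)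
    have "y n \<noteq> z n" using e n by metis
    then have hz: "h z = z n" using h(2)[OF D(3)] by (auto simp: collapse_def split: if_splits)
    have "h y = v \<or> h y = y n" using h(2)[OF D(2)] by (auto simp: collapse_def split: if_splits)
    moreover have "h y \<noteq> y n" using hE(1) hx yx V v by auto
    ultimately have "(v, z n) \<in> gE ?B" using hE(2) hz by simp
    then have "z n = y n \<or> z n = x n" using v V edge_in[of v "z n" n] by auto
    then show False using \<open>y n \<noteq> z n\<close> n edge_refl V by auto
  qed
qed

sublocale tm3_trans
  by unfold_locales (rule trans_E)

lemma ramification_dense:
  assumes V: "openin Y V" and z: "z \<in> D" "q z \<in> V"
  shows "\<exists>p\<in>V. ramification_point Y p"
proof -
  obtain n where n: "\<And>w. w \<in> D \<Longrightarrow> (z n, w n) \<in> gE (F n) \<Longrightarrow> q w \<in> V"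
    using star_subset[OF V z] by blast
  have zV: "z n \<in> gV (F n)" using z limV_in by blast
  obtain B g c d1 d2 d3 L1 L2 L3 where B: "tm3_mor B (F n) g" "c \<in> gV B" "g c = z n"
    and L: "\<forall>(d, L) \<in> {(d1, L1), (d2, L2), (d3, L3)}.
         L \<subseteq> gV B \<and> gconnected B L \<and> c \<in> L \<and> d \<in> L \<and> (c, d) \<notin> gE B"
    and I: "L1 \<inter> L2 = {c}" "L1 \<inter> L3 = {c}" "L2 \<inter> L3 = {c}"
    using tripod[OF obj zV] by (elim exE conjE)
  obtain h where h: "fomega_epi F \<alpha> B h" "\<And>w. w \<in> D \<Longrightarrow> w n = g (h w)" using refine[OF B(1)] by blast
  have "\<exists>m h'. tm3_mor (F m) B h' \<and> (\<forall>w\<in>D. h w = h' (w m))"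
    using h(1) unfolding fomega_epi_def by (elim conjE)
  then obtain m h' where h': "tm3_mor (F m) B h'" "\<And>w. w \<in> D \<Longrightarrow> h w = h' (w m)" by blast
  have treeB: "is_tree B" using tm3_mor_tree(1)[OF B(1)] .
  have hD: "h ` D = gV B" using h(1) unfolding fomega_epi_def by (elim conjE)
  have "\<forall>u w. (u, w) \<in> E \<longrightarrow> (h u, h w) \<in> gE B" using h(1) unfolding fomega_epi_def by (elim conjE)
  then have hE: "\<And>u w. (u, w) \<in> E \<Longrightarrow> (h u, h w) \<in> gE B" by blast
  have "d1 \<in> h ` D" "d2 \<in> h ` D" "d3 \<in> h ` D" unfolding hD using L by auto
  then obtain x1 x2 x3 where x: "x1 \<in> D" "x2 \<in> D" "x3 \<in> D" "d1 = h x1" "d2 = h x2" "d3 = h x3" by blast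
  obtain r where r: "r \<in> seg x1 x2" "r \<in> seg x2 x3" "r \<in> seg x1 x3" using seg_median[OF x(1-3)] by blast
  have rD: "r \<in> D" using r segD by blast
  \<comment> \<open>\<open>h\<close> factors through a level by a monotone map, so it sends a
    segment into the interval between the images of its ends. Two legs together form a connected set
    containing that interval.\<close>
  have between: "h r \<in> L \<union> L'" if "r \<in> seg u w" "u \<in> D" "w \<in> D"
      "gconnected B L" "gconnected B L'" "L \<subseteq> gV B" "L' \<subseteq> gV B" "c \<in> L" "c \<in> L'" "h u \<in> L" "h w \<in> L'"
    for u w L L'
  proof -
    have "h r \<in> iv B (h u) (h w)"
      using tm3_mor_iv[OF h'(1) limV_in[OF that(2)] limV_in[OF that(3)] segD(2)[OF that(1)]] h'(2) that rD by simp
    moreover have "iv B (h u) (h w) \<subseteq> L \<union> L'"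
      using that by (intro iv_least[OF treeB] gconnected_Un) auto
    ultimately show ?thesis by blast
  qed
  have "h r \<in> L1 \<union> L2" "h r \<in> L2 \<union> L3" "h r \<in> L1 \<union> L3"
    using between[OF r(1) x(1,2), of L1 L2] between[OF r(2) x(2,3), of L2 L3] between[OF r(3) x(1,3), of L1 L3] L x
    by auto
  \<comment> \<open>The legs meet pairwise only in \<open>c\<close>, so no other vertex lies in all
    three unions of two legs.\<close>
  then have "h r = c" using I by blast
  have "(r, x1) \<notin> E" "(r, x2) \<notin> E" "(r, x3) \<notin> E"
    using hE[of r x1] hE[of r x2] hE[of r x3] L x \<open>h r = c\<close> by auto
  then have "ramification_point Y (q r)" using ramification_median[OF x(1-3) r] by blast
  moreover have "q r \<in> V"
    using n[OF rD] h(2)[OF rD] \<open>h r = c\<close> B(3) edge_refl[OF zV] by simp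
  ultimately show ?thesis by blast
qed

lemma closure_ramification:
  "Y closure_of {p \<in> topspace Y. ramification_point Y p} = topspace Y"
proof
  show "Y closure_of {p \<in> topspace Y. ramification_point Y p} \<subseteq> topspace Y"
    by (rule closure_of_subset_topspace)
  show "topspace Y \<subseteq> Y closure_of {p \<in> topspace Y. ramification_point Y p}"
  proof
    fix p assume p: "p \<in> topspace Y"
    then obtain z where z: "z \<in> D" "p = q z" unfolding topspace_Y by blast
    have "\<exists>s. s \<in> {p \<in> topspace Y. ramification_point Y p} \<and> s \<in> T" if T: "p \<in> T" "openin Y T" for T
      using ramification_dense[OF T(2) z(1)] T z openin_subset by blast
    then show "p \<in> Y closure_of {p \<in> topspace Y. ramification_point Y p}"
      using p unfolding in_closure_of by blast
  qed
qed

end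

theorem theorem3p14:
  fixes F :: "nat \<Rightarrow> fgraph" and \<alpha> :: "nat \<Rightarrow> nat \<Rightarrow> nat"
  assumes "tm3_fraisse_limit F \<alpha>"
  shows "trans (limE F \<alpha>)
    \<and> dendrite (realization F \<alpha>)
    \<and> (realization F \<alpha>) closure_of {p \<in> topspace (realization F \<alpha>). ramification_point (realization F \<alpha>) p}
        = topspace (realization F \<alpha>)"
proof -
  interpret tm3_fraisse F \<alpha> by unfold_locales (rule assms)
  show ?thesis by (intro conjI trans_E dendrite_Y closure_ramification)
qed

end
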